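(* Let $n\ge 1$ and $d\ge 1$ be integers. Let $A_1,\dots,A_n:\mathbb{R}^d\rightrightarrows\mathbb{R}^d$ be maximal monotone operators, and let $B:\mathbb{R}^d\to\mathbb{R}^d$ be monotone and $L$-Lipschitz continuous for some $L>0$. Assume the inclusion $0\in\sum_{i=1}^n A_i(z)+B(z)$ has at least one solution $z\in\mathbb{R}^d$. Run Algorithm SPS (described in the context) with $\tau>0$, an initial point $p^1=(z^1,w_1^1,\dots,w_{n+1}^1)\in\mathbb{R}^{(n+2)d}$ satisfying $\sum_{i=1}^{n+1}w_i^1=0$, and deterministic stepsizes $\alpha_k>0,\rho_k>0$. Suppose the noise terms satisfy, almost surely for every $k$, $$\mathbb{E}[\epsilon^k\mid\mathcal{F}_k]=0,\quad \mathbb{E}[e^k\mid\mathcal{F}_k]=0,$$ $$\mathbb{E}[\|\epsilon^k\|^2\mid\mathcal{F}_k]\le N_1+N_2\|B(z^k)\|^2,\qquad \mathbb{E}[\|e^k\|^2\mid\mathcal{F}_k,\mathcal{E}_k]\le N_3+N_4\|B(x_{n+1}^k)\|^2,$$ for constants $0\le N_1,N_2,N_3,N_4<\infty$, and suppose the stepsizes satisfy $$\sum_{k=1}^\infty\alpha_k\rho_k=\infty,\quad \sum_{k=1}^\infty\alpha_k^2<\infty,\quad \sum_{k=1}^\infty\alpha_k\rho_k^2<\infty,\quad \rho_k\le\bar\rho<\frac1L\ \text{ for all }k,$$ for some constant $\bar\rho$. Then with probability one, $z^k\to z^*$ for some (random) $z^*$ satisfying $0\in\sum_{i=1}^n A_i(z^*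 )+B(z^* )$.
   Context: For a maximal monotone $A$ and $\tau>0$, the resolvent is $J_{\tau A}=(I+\tau A)^{-1}$, which is single-valued with domain $\mathbb{R}^d$. Algorithm SPS (Stochastic Projective Splitting): given $p^k=(z^k,w_1^k,\dots,w_{n+1}^k)$, for $i=1,\dots,n$ set $t_i^k=z^k+\tau w_i^k$, $x_i^k=J_{\tau A_i}(t_i^k)$, $y_i^k=\tau^{-1}(t_i^k-x_i^k)$. Then set $r^k=B(z^k)+\epsilon^k$, $x_{n+1}^k=z^k-\rho_k(r^k-w_{n+1}^k)$, $y_{n+1}^k=B(x_{n+1}^k)+e^k$, where $\epsilon^k,e^k$ are $\mathbb{R}^d$-valued random variables (unknown noise of a stochastic oracle for $B$) on a probability space $(\Omega,\mathcal{F},P)$. Finally set $z^{k+1}=z^k-\alpha_k\sum_{i=1}^{n+1}y_i^k$ and $w_i^{k+1}=w_i^k-\alpha_k\big(x_i^k-\frac{1}{n+1}\sum_{j=1}^{n+1}x_j^k\big)$ for $i=1,\dots,n+1$. Here $\mathcal{F}_k=\sigma(p^1,\dots,p^k)$ and $\mathcal{E}_k=\sigma(\epsilon^k)$; $\epsilon^k$ and $e^k$ need not be independent. *)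

theory Defs
  imports "HOL-Analysis.Analysis" "HOL-Probability.Probability"
begin

definition monotone_op :: "('a::real_inner \<Rightarrow> 'a set) \<Rightarrow> bool" where
  "monotone_op A \<longleftrightarrow> (\<forall>x y u v. u \<in> A x \<longrightarrow> v \<in> A y \<longrightarrow> inner (u - v) (x - y) \<ge> 0)"

definition maximal_monotone :: "('a::real_inner \<Rightarrow> 'a set) \<Rightarrow> bool" where
  "maximal_monotone A \<longleftrightarrow> monotone_op A \<and>
     (\<forall>x u. (\<forall>y v. v \<in> A y \<longrightarrow> inner (u - v) (x - y) \<ge> 0) \<longrightarrow> u \<in> A x)"

definition monotone_fun :: "('a::real_inner \<Rightarrow> 'a) \<Rightarrow> bool" where
  "monotone_fun B \<longleftrightarrow> (\<forall>x y. inner (B x - B y) (x - y) \<ge> 0)"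

text \<open>Resolvent J_{tau A} = (I + tau A)^{-1}: J(t) is the x with (t - x)/tau \<in> A x.\<close>
definition resolvent :: "real \<Rightarrow> ('a::real_vector \<Rightarrow> 'a set) \<Rightarrow> 'a \<Rightarrow> 'a" where
  "resolvent tau A t = (THE x. (1 / tau) *\<^sub>R (t - x) \<in> A x)"

definition is_solution :: "(nat \<Rightarrow> 'a::real_vector \<Rightarrow> 'a set) \<Rightarrow> ('a \<Rightarrow> 'a) \<Rightarrow> nat \<Rightarrow> 'a \<Rightarrow> bool" where
  "is_solution A B n z \<longleftrightarrow> (\<exists>a. (\<forall>i\<in>{1..n}. a i \<in> A i z) \<and> (\<Sum>i=1..n. a i) + B z = 0)"

definition sps_x :: "(nat \<Rightarrow> 'a::real_vector \<Rightarrow> 'a set) \<Rightarrow> ('a \<Rightarrow> 'a) \<Rightarrow> nat \<Rightarrow> real \<Rightarrow> real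
     \<Rightarrow> 'a \<Rightarrow> (nat \<Rightarrow> 'a) \<Rightarrow> 'a \<Rightarrow> nat \<Rightarrow> 'a" where
  "sps_x A B n tau rho zk wk epsk i =
     (if i \<le> n then resolvent tau (A i) (zk + tau *\<^sub>R wk i)
      else zk - rho *\<^sub>R ((B zk + epsk) - wk (n + 1)))"

definition sps_y :: "(nat \<Rightarrow> 'a::real_vector \<Rightarrow> 'a set) \<Rightarrow> ('a \<Rightarrow> 'a) \<Rightarrow> nat \<Rightarrow> real \<Rightarrow> real
     \<Rightarrow> 'a \<Rightarrow> (nat \<Rightarrow> 'a) \<Rightarrow> 'a \<Rightarrow> 'a \<Rightarrow> nat \<Rightarrow> 'a" where
  "sps_y A B n tau rho zk wk epsk ek i =
     (if i \<le> n then (1 / tau) *\<^sub>R ((zk + tau *\<^sub>R wk i) - sps_x A B n tau rho zk wk epsk i)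
      else B (sps_x A B n tau rho zk wk epsk (n + 1)) + ek)"

definition gen_sigma :: "'b measure \<Rightarrow> ('b \<Rightarrow> 'a::topological_space) set \<Rightarrow> 'b measure" where
  "gen_sigma M Fs = sigma (space M) (\<Union>f\<in>Fs. {f -` S \<inter> space M | S. S \<in> sets borel})"

definition sps_filt :: "'b measure \<Rightarrow> nat \<Rightarrow> (nat \<Rightarrow> 'b \<Rightarrow> 'a::topological_space)
     \<Rightarrow> (nat \<Rightarrow> nat \<Rightarrow> 'b \<Rightarrow> 'a) \<Rightarrow> nat \<Rightarrow> 'b measure" where
  "sps_filt M n z w k = gen_sigma M ({z j | j. 1 \<le> j \<and> j \<le> k} \<union> {w j i | j i. 1 \<le> j \<and> j \<le> k \<and> 1 \<le> i \<and> i \<le> n + 1})"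

definition sps_filt_eps :: "'b measure \<Rightarrow> nat \<Rightarrow> (nat \<Rightarrow> 'b \<Rightarrow> 'a::topological_space)
     \<Rightarrow> (nat \<Rightarrow> nat \<Rightarrow> 'b \<Rightarrow> 'a) \<Rightarrow> (nat \<Rightarrow> 'b \<Rightarrow> 'a) \<Rightarrow> nat \<Rightarrow> 'b measure" where
  "sps_filt_eps M n z w eps k = gen_sigma M ({z j | j. 1 \<le> j \<and> j \<le> k} \<union> {w j i | j i. 1 \<le> j \<and> j \<le> k \<and> 1 \<le> i \<and> i \<le> n + 1} \<union> {eps k})"

end

theory Submission
  imports Defs
begin

text \<open>The algorithm is a noisy projection method onto the extended solution set of all
  \<open>q = (z, w\<^sub>1, \<dots>, w\<^sub>n\<^sub>+\<^sub>1)\<close> with \<open>w\<^sub>i \<in> A\<^sub>i z\<close>, \<open>w\<^sub>n\<^sub>+\<^sub>1 = B z\<close> and \<open>\<Sum> w\<^sub>i = 0\<close>. For a fixed \<open>q\<close> in this set,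
  monotonicity gives a conditional descent inequality for the squared distance of the iterate to \<open>q\<close>:
  up to a factor and an additive error that are summable, the distance decreases by a multiple of \<open>\<alpha>\<^sub>k \<rho>\<^sub>k\<close>
  times a residual that vanishes exactly on the extended solution set. The cross term between the
  two noises cancels, so that only \<open>\<langle>z\<^sup>k - z\<^sup>*, e\<^sup>k\<rangle>\<close> remains and a zero mean of \<open>e\<^sup>k\<close> given the past iterates suffices.
  By the Robbins--Siegmund argument the distances converge almost surely, simultaneously for all \<open>q\<close> in a
  countable dense subset, and the residual tends to zero along a subsequence because \<open>\<Sum> \<alpha>\<^sub>k \<rho>\<^sub>k = \<infinity>\<close>.
  A cluster point along that subsequence is an extended solution, and Opial's argument turns it into the limit.\<close>

section \<open>Resolvents of maximal monotone operators\<close>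

text \<open>The two kinds of blocks descend at different rates: a resolvent block gains a multiple
  of \<open>alpha k\<close>, the forward block only of \<open>alpha k * rho k\<close>. Since
  \<open>rho k \<le> rhobar\<close>, the smaller weight serves for both. The noise
  \<open>eps k\<close> sits inside the forward point, and the Lipschitz estimate of \<open>B\<close>
  between \<open>z\<close> and that point squares the displacement; this is the source of the error
  \<open>alpha k * (rho k)^2\<close>. The error \<open>(alpha k)^2\<close> is the second-order term
  of a step whose length is prescribed instead of being the projection length. The variance bound of
  \<open>e k\<close> depends on the forward point, hence on \<open>eps k\<close>: it is used under
  the finer sigma-algebra, whereas the mean of \<open>e k\<close> is used under the coarser one. The
  descent is available for a deterministic \<open>q\<close>, with an exceptional null set depending
  on \<open>q\<close>, while the limit is random; hence the detour through countably many
  \<open>q\<close>. Finally, \<open>resolvent\<close> is a definite description, so the algorithm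
  says nothing about the operators until existence and uniqueness of the described point are
  established; existence is Minty's theorem, obtained by compactness.\<close>

lemma convex_hull_monotone_pairs:
  fixes F :: "('a::real_inner \<times> 'a) set"
  assumes mono: "\<And>a b a' b'. (a, b) \<in> F \<Longrightarrow> (a', b') \<in> F \<Longrightarrow> inner (b - b') (a - a') \<le> 0"
    and hull: "(a, b, s) \<in> convex hull ((\<lambda>(a, b). (a, b, inner a b)) ` F)"
  shows "s \<le> inner a b"
proof -
  let ?Q = "(\<lambda>(a, b). (a, b, inner a b)) ` F"
  \<comment> \<open>The inequality is affine in \<open>(a, b, s)\<close>, so it passes from the
    generators to their convex hull. Monotonicity is a condition on two points: one slot is extended
    to the hull here, the other below.\<close>
  have 1: "s \<le> inner a b0 + inner b a0 - inner a0 b0"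
    if F0: "(a0, b0) \<in> F" and h: "(a, b, s) \<in> convex hull ?Q" for a0 b0 a b s
  proof -
    let ?H = "{p. inner (- b0, - a0, 1::real) p \<le> - inner a0 b0}"
    have "?Q \<subseteq> ?H"
    proof (rule image_subsetI)
      fix p assume "p \<in> F"
      then obtain a b where p: "p = (a, b)" "(a, b) \<in> F" by (cases p) auto
      from mono[OF p(2) F0] show "(case p of (a, b) \<Rightarrow> (a, b, inner a b)) \<in> ?H"
        by (simp add: p(1) inner_diff_left inner_diff_right inner_commute)
    qed
    then have "convex hull ?Q \<subseteq> ?H" by (rule hull_minimal) (rule convex_halfspace_le)
    with h have "(a, b, s) \<in> ?H" by (rule rev_subsetD)
    then show ?thesis by (simp add: inner_commute)
  qed
  \<comment> \<open>The hull point \<open>(a, b, s)\<close> now determines the halfspace; that it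
    lies in its own halfspace reads \<open>2 * s \<le> 2 * inner a b\<close>.\<close>
  let ?H = "{p. inner (- b, - a, 1::real) p \<le> - s}"
  have "?Q \<subseteq> ?H"
  proof (rule image_subsetI)
    fix p assume "p \<in> F"
    then obtain a0 b0 where p: "p = (a0, b0)" "(a0, b0) \<in> F" by (cases p) auto
    from 1[OF p(2) hull] show "(case p of (a, b) \<Rightarrow> (a, b, inner a b)) \<in> ?H"
      by (simp add: p(1) inner_commute)
  qed
  then have "convex hull ?Q \<subseteq> ?H" by (rule hull_minimal) (rule convex_halfspace_le)
  with hull have "(a, b, s) \<in> ?H" by (rule rev_subsetD)
  then show ?thesis by (simp add: inner_commute)
qed

text \<open>A dual argument: \<open>x\<close> maximises the concave dual function \<open>s - \<parallel>(a + b) / 2\<parallel>\<^sup>2\<close> over the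
  convex hull of the points \<open>(a, b, a \<bullet> b)\<close>, whose value is nonpositive by monotonicity.\<close>

lemma finite_monotone_extension:
  fixes F :: "('a::euclidean_space \<times> 'a) set"
  assumes fin: "finite F"
    and mono: "\<And>a b a' b'. (a, b) \<in> F \<Longrightarrow> (a', b') \<in> F \<Longrightarrow> inner (b - b') (a - a') \<le> 0"
  shows "\<exists>x. \<forall>(a, b)\<in>F. inner (x - b) (x - a) \<le> 0"
proof (cases "F = {}")
  case False
  let ?Q = "(\<lambda>(a, b). (a, b, inner a b)) ` F"
  let ?K = "convex hull ?Q"
  \<comment> \<open>The minimum over \<open>x\<close> of
    \<open>(norm x)^2 - inner x (a + b) + s\<close> is attained at \<open>m p\<close>, with value
    \<open>D p\<close>; on a generator the minimised expression is
    \<open>inner (x - b) (x - a)\<close>.\<close>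
  define m :: "'a \<times> 'a \<times> real \<Rightarrow> 'a" where "m p = (1/2) *\<^sub>R (fst p + fst (snd p))" for p
  define D where "D p = snd (snd p) - (norm (m p))\<^sup>2" for p
  have "compact ?K" using fin by (intro finite_imp_compact_convex_hull) auto
  moreover have "?K \<noteq> {}" using False by auto
  moreover have "continuous_on ?K D"
    unfolding D_def m_def by (intro continuous_intros)
  ultimately have "\<exists>p\<in>?K. \<forall>q\<in>?K. D q \<le> D p" by (rule continuous_attains_sup)
  then obtain p where p: "p \<in> ?K" and pmax: "\<And>q. q \<in> ?K \<Longrightarrow> D q \<le> D p" by blast
  define x where "x = m p"
  \<comment> \<open>First-order optimality of the maximiser: compare with the point at parameter
    \<open>t\<close> on the segment towards \<open>q\<close>, divide by \<open>t\<close>, and let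
    \<open>t\<close> tend to 0 from the right.\<close>
  have foc: "snd (snd q) - snd (snd p) \<le> 2 * inner x (m q - x)" if q: "q \<in> ?K" for q
  proof -
    define d where "d = m q - x"
    have ineq: "snd (snd q) - snd (snd p) \<le> 2 * inner x d + t * (norm d)\<^sup>2" if t: "0 < t" "t \<le> 1" for t
    proof -
      let ?r = "(1 - t) *\<^sub>R p + t *\<^sub>R q"
      have "?r \<in> ?K" using t p q convex_convex_hull[of ?Q] unfolding convex_alt by auto
      from pmax[OF this] have "D ?r \<le> D p" .
      moreover have "m ?r = x + t *\<^sub>R d"
        unfolding d_def x_def m_def by (simp add: algebra_simps)
      moreover have "snd (snd ?r) = snd (snd p) + t * (snd (snd q) - snd (snd p))"
        by (simp add: algebra_simps)
      ultimately have "t * (snd (snd q) - snd (snd p)) \<le> (norm (x + t *\<^sub>R d))\<^sup>2 - (norm x)\<^sup>2"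
        unfolding D_def x_def by simp
      also have "\<dots> = t * (2 * inner x d + t * (norm d)\<^sup>2)"
        unfolding power2_norm_eq_inner by (simp add: algebra_simps inner_commute)
      finally show ?thesis using t by simp
    qed
    have "((\<lambda>t. 2 * inner x d + t * (norm d)\<^sup>2) \<longlongrightarrow> 2 * inner x d + 0 * (norm d)\<^sup>2) (at_right 0)"
      by (intro tendsto_intros)
    moreover have "\<forall>\<^sub>F t in at_right (0::real). snd (snd q) - snd (snd p) \<le> 2 * inner x d + t * (norm d)\<^sup>2"
      unfolding eventually_at_right_field using ineq by (intro exI[of _ 1]) auto
    ultimately have "snd (snd q) - snd (snd p) \<le> 2 * inner x d + 0 * (norm d)\<^sup>2"
      by (intro tendsto_lowerbound) auto
    then show ?thesis by (simp add: d_def)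
  qed
  obtain a b s where abs: "p = (a, b, s)" by (cases p) auto
  have "s \<le> inner a b" using convex_hull_monotone_pairs[OF mono] p abs by blast
  also have "\<dots> \<le> (norm x)\<^sup>2"
  proof -
    have "(norm x)\<^sup>2 - inner a b = (norm ((1/2) *\<^sub>R (a - b)))\<^sup>2"
      unfolding x_def m_def abs power2_norm_eq_inner by (simp add: algebra_simps inner_commute)
    then show ?thesis by (metis diff_ge_0_iff_ge zero_le_power2)
  qed
  finally have s: "s \<le> (norm x)\<^sup>2" .
  show ?thesis
  proof (intro exI ballI, clarify)
    fix a' b' assume "(a', b') \<in> F"
    then have "(a', b', inner a' b') \<in> ?K" by (auto intro!: hull_inc)
    from foc[OF this] s show "inner (x - b') (x - a') \<le> 0"
      by (simp add: abs m_def power2_norm_eq_inner algebra_simps inner_commute)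
  qed
qed auto

text \<open>Expanding around the midpoint shows that this is the Thales ball with diameter from
  \<open>a\<close> to \<open>b\<close>; its compactness is what reduces an infinite family of such
  conditions to finite ones.\<close>

lemma compact_inner_diff_le_0: "compact {x::'a::euclidean_space. inner (x - b) (x - a) \<le> 0}"
proof -
  have "{x. inner (x - b) (x - a) \<le> 0} = cball ((1/2) *\<^sub>R (a + b)) (norm ((1/2) *\<^sub>R (a - b)))"
  proof (intro set_eqI)
    fix x
    have "(norm ((1/2) *\<^sub>R (a + b) - x))\<^sup>2 - (norm ((1/2) *\<^sub>R (a - b)))\<^sup>2 = inner (x - b) (x - a)"
      unfolding power2_norm_eq_inner by (simp add: algebra_simps inner_commute)
    then have "inner (x - b) (x - a) \<le> 0 \<longleftrightarrow>
        (norm ((1/2) *\<^sub>R (a + b) - x))\<^sup>2 \<le> (norm ((1/2) *\<^sub>R (a - b)))\<^sup>2" by linarith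
    then show "x \<in> {x. inner (x - b) (x - a) \<le> 0} \<longleftrightarrow>
        x \<in> cball ((1/2) *\<^sub>R (a + b)) (norm ((1/2) *\<^sub>R (a - b)))"
      by (simp add: dist_norm power_mono_iff)
  qed
  then show ?thesis by simp
qed

text \<open>Surjectivity of \<open>I + tau A\<close>. By maximality the inclusion holds as soon as
  \<open>x\<close> is monotonically related to every pair of the graph, and after the substitution
  \<open>b = t - tau v\<close> each such requirement is a Thales ball. Finite subfamilies meet by
  \<open>finite_monotone_extension\<close>, so the whole family does by compactness.\<close>

theorem minty:
  fixes A :: "'a::euclidean_space \<Rightarrow> 'a set"
  assumes A: "maximal_monotone A" and tau: "tau > 0"
  shows "\<exists>x. (1 / tau) *\<^sub>R (t - x) \<in> A x"
proof -
  let ?C = "\<lambda>(a, b). {x. inner (x - b) (x - a) \<le> 0}"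
  let ?F = "{(y, t - tau *\<^sub>R v) | y v. v \<in> A y}"
  have monoA: "\<And>x y u v. u \<in> A x \<Longrightarrow> v \<in> A y \<Longrightarrow> inner (u - v) (x - y) \<ge> 0"
    using A unfolding maximal_monotone_def monotone_op_def by blast
  \<comment> \<open>The graph is nonempty: on an empty graph the maximality condition would hold
    vacuously and put every \<open>u\<close> into \<open>A x\<close>. One pair supplies the compact
    set from which the finite intersection property starts.\<close>
  obtain y0 v0 where 0: "v0 \<in> A y0" using A unfolding maximal_monotone_def by blast
  let ?p0 = "(y0, t - tau *\<^sub>R v0)"
  have "?C ?p0 \<inter> \<Inter> (?C ` ?F) \<noteq> {}"
  proof (rule compact_imp_fip)
    show "compact (?C ?p0)" by (simp add: compact_inner_diff_le_0)
    show "closed T" if "T \<in> ?C ` ?F" for T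
      using that by (auto intro!: compact_imp_closed compact_inner_diff_le_0)
  next
    fix F' assume F': "finite F'" "F' \<subseteq> ?C ` ?F"
    then obtain P where P: "P \<subseteq> ?F" "finite P" "F' = ?C ` P"
      by (meson finite_subset_image)
    have "\<exists>x. \<forall>(a, b)\<in>insert ?p0 P. inner (x - b) (x - a) \<le> 0"
    proof (rule finite_monotone_extension)
      show "finite (insert ?p0 P)" using P by simp
      fix a b a' b' assume "(a, b) \<in> insert ?p0 P" "(a', b') \<in> insert ?p0 P"
      then have "(a, b) \<in> ?F" "(a', b') \<in> ?F" using P(1) 0 by auto
      then obtain v v' where v: "v \<in> A a" "v' \<in> A a'" "b = t - tau *\<^sub>R v" "b' = t - tau *\<^sub>R v'" by auto
      then have "inner (b - b') (a - a') = - (tau * inner (v - v') (a - a'))"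
        unfolding v(3,4) by (simp add: inner_diff_left algebra_simps)
      then show "inner (b - b') (a - a') \<le> 0" using monoA[OF v(1,2)] tau by simp
    qed
    then show "?C ?p0 \<inter> \<Inter> F' \<noteq> {}" unfolding P(3) by fastforce
  qed
  then obtain x where x: "\<And>y v. v \<in> A y \<Longrightarrow> inner (x - (t - tau *\<^sub>R v)) (x - y) \<le> 0"
    by fastforce
  have "inner ((1 / tau) *\<^sub>R (t - x) - v) (x - y) \<ge> 0" if "v \<in> A y" for y v
  proof -
    have "inner ((1 / tau) *\<^sub>R (t - x) - v) (x - y) = - (1 / tau) * inner (x - (t - tau *\<^sub>R v)) (x - y)"
      using tau by (simp add: algebra_simps inner_diff_left divide_simps)
    then show ?thesis using x[OF that] tau by (simp add: mult_nonneg_nonpos zero_le_divide_iff divide_le_0_iff)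
  qed
  then show ?thesis using A unfolding maximal_monotone_def by blast
qed

text \<open>Monotonicity gives firm nonexpansiveness,
  \<open>(norm (x - y))^2 \<le> inner (t - s) (x - y)\<close>, and Cauchy-Schwarz does the rest. The
  points enter through their inclusions, so that the case \<open>t = s\<close> can supply the
  uniqueness behind the definite description.\<close>

lemma monotone_op_resolvent_nonexpansive:
  fixes A :: "'a::real_inner \<Rightarrow> 'a set"
  assumes A: "monotone_op A" and tau: "tau > 0"
    and x: "(1 / tau) *\<^sub>R (t - x) \<in> A x" and y: "(1 / tau) *\<^sub>R (s - y) \<in> A y"
  shows "norm (x - y) \<le> norm (t - s)"
proof -
  have "inner ((1 / tau) *\<^sub>R (t - x) - (1 / tau) *\<^sub>R (s - y)) (x - y) \<ge> 0"
    using A x y unfolding monotone_op_def by blast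
  also have "inner ((1 / tau) *\<^sub>R (t - x) - (1 / tau) *\<^sub>R (s - y)) (x - y)
      = (inner (t - s) (x - y) - (norm (x - y))\<^sup>2) / tau"
  proof -
    have "(1 / tau) *\<^sub>R (t - x) - (1 / tau) *\<^sub>R (s - y) = (1 / tau) *\<^sub>R ((t - s) - (x - y))"
      by (simp add: algebra_simps)
    then show ?thesis by (simp only: inner_scaleR_left inner_diff_left[of "t - s"] power2_norm_eq_inner) simp
  qed
  finally have "(norm (x - y))\<^sup>2 \<le> inner (t - s) (x - y)"
    using tau by (simp add: zero_le_divide_iff)
  also have "\<dots> \<le> norm (t - s) * norm (x - y)" by (rule norm_cauchy_schwarz)
  finally show ?thesis
    by (metis mult_le_cancel_right norm_ge_zero norm_le_zero_iff order.trans power2_eq_square linorder_not_less)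
qed

lemma resolvent_unique:
  fixes A :: "'a::real_inner \<Rightarrow> 'a set"
  assumes "monotone_op A" "tau > 0" "(1 / tau) *\<^sub>R (t - x) \<in> A x"
  shows "resolvent tau A t = x"
  unfolding resolvent_def
  using assms monotone_op_resolvent_nonexpansive[OF assms(1,2), of t _ t]
  by (intro the_equality) fastforce+

lemma resolvent_in:
  fixes A :: "'a::euclidean_space \<Rightarrow> 'a set"
  assumes "maximal_monotone A" "tau > 0"
  shows "(1 / tau) *\<^sub>R (t - resolvent tau A t) \<in> A (resolvent tau A t)"
  using minty[OF assms, of t] resolvent_unique[OF _ assms(2), of A t] assms(1)
  unfolding maximal_monotone_def by metis

lemma resolvent_nonexpansive:
  fixes A :: "'a::euclidean_space \<Rightarrow> 'a set"
  assumes "maximal_monotone A" "tau > 0"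
  shows "norm (resolvent tau A t - resolvent tau A s) \<le> norm (t - s)"
  using assms by (intro monotone_op_resolvent_nonexpansive[OF _ _ resolvent_in resolvent_in])
    (auto simp: maximal_monotone_def)

lemma continuous_resolvent:
  fixes A :: "'a::euclidean_space \<Rightarrow> 'a set"
  assumes "maximal_monotone A" "tau > 0"
  shows "continuous_on UNIV (resolvent tau A)"
  unfolding continuous_on_iff dist_norm
  using resolvent_nonexpansive[OF assms] by (meson UNIV_I order.strict_trans1)

section \<open>Almost sure convergence of supermartingales\<close>

lemma measurable_filtration:
  assumes step: "\<And>k. subalgebra (F (Suc k)) (F k)" and f: "f \<in> measurable (F k) N" and kj: "k \<le> j"
  shows "f \<in> measurable (F j) N"
  using kj
proof (induction rule: dec_induct)
  case (step i)
  then show ?case using measurable_from_subalg[OF assms(1)] by blast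
qed (rule f)

text \<open>Supermartingales are described by testing against bounded nonnegative functions that are
  measurable in the past, which avoids conditional expectations.\<close>

lemma unit_submartingale_converges:
  fixes Y :: "nat \<Rightarrow> 'b \<Rightarrow> real"
  assumes "prob_space M"
    and sub: "\<And>k. subalgebra M (F k)" and filt: "\<And>k. subalgebra (F (Suc k)) (F k)"
    and meas: "\<And>k. Y k \<in> borel_measurable (F k)"
    and Y0: "\<And>k \<omega>. 0 \<le> Y k \<omega>" and Y1: "\<And>k \<omega>. Y k \<omega> \<le> 1"
    and submart: "\<And>k g. g \<in> borel_measurable (F k) \<Longrightarrow> (\<And>\<omega>. 0 \<le> g \<omega>) \<Longrightarrow> (\<And>\<omega>. g \<omega> \<le> 1)
       \<Longrightarrow> (\<integral>\<omega>. g \<omega> * Y k \<omega> \<partial>M) \<le> (\<integral>\<omega>. g \<omega> * Y (Suc k) \<omega> \<partial>M)"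
  shows "AE \<omega> in M. convergent (\<lambda>k. Y k \<omega>)"
proof -
  interpret prob_space M by fact
  have mF: "f \<in> borel_measurable (F k) \<Longrightarrow> f \<in> borel_measurable M" for f :: "'b \<Rightarrow> real" and k
    using measurable_from_subalg[OF sub] by blast
  note [measurable] = mF[OF meas]
  have bint: "integrable M f" if "f \<in> borel_measurable M" "\<And>\<omega>. 0 \<le> f \<omega>" "\<And>\<omega>. f \<omega> \<le> 1" for f :: "'b \<Rightarrow> real"
    using that by (intro integrable_const_bound[where B=1]) auto
  have sqle: "2 * Y k \<omega> * (Y (Suc k) \<omega> - Y k \<omega>) \<le> (Y (Suc k) \<omega>)\<^sup>2 - (Y k \<omega>)\<^sup>2" for k \<omega>
    using zero_le_power2[of "Y (Suc k) \<omega> - Y k \<omega>"] by (simp add: power2_eq_square algebra_simps)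
  \<comment> \<open>Squares of \<open>Y\<close> again form a submartingale: convexity bounds the
    increment of the square below by \<open>2 * Y k\<close> times the increment of \<open>Y\<close>,
    and \<open>g * Y k\<close> is an admissible test function because \<open>Y\<close> stays in the
    unit interval.\<close>
  have sqmono: "(\<integral>\<omega>. g \<omega> * (Y k \<omega>)\<^sup>2 \<partial>M) \<le> (\<integral>\<omega>. g \<omega> * (Y (Suc k) \<omega>)\<^sup>2 \<partial>M)"
    if g: "g \<in> borel_measurable (F k)" "\<And>\<omega>. 0 \<le> g \<omega>" "\<And>\<omega>. g \<omega> \<le> 1" for g k
  proof -
    have [measurable]: "g \<in> borel_measurable M" using mF g by blast
    note b = g Y0 Y1 mult_le_one power_le_one mult_nonneg_nonneg
    have i: "integrable M (\<lambda>\<omega>. (g \<omega> * Y k \<omega>) * Y j \<omega>)" "integrable M (\<lambda>\<omega>. g \<omega> * (Y j \<omega>)\<^sup>2)" for j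
      by (intro bint; (measurable; fail | auto simp: b intro!: mult_le_one power_le_one))+
    have "(\<integral>\<omega>. (g \<omega> * Y k \<omega>) * Y k \<omega> \<partial>M) \<le> (\<integral>\<omega>. (g \<omega> * Y k \<omega>) * Y (Suc k) \<omega> \<partial>M)"
      using g meas[of k] by (intro submart borel_measurable_times b)
    then have "0 \<le> (\<integral>\<omega>. 2 * ((g \<omega> * Y k \<omega>) * Y (Suc k) \<omega> - (g \<omega> * Y k \<omega>) * Y k \<omega>) \<partial>M)"
      using i by simp
    also have "\<dots> \<le> (\<integral>\<omega>. g \<omega> * (Y (Suc k) \<omega>)\<^sup>2 - g \<omega> * (Y k \<omega>)\<^sup>2 \<partial>M)"
    proof (intro integral_mono)
      fix \<omega>
      show "2 * ((g \<omega> * Y k \<omega>) * Y (Suc k) \<omega> - (g \<omega> * Y k \<omega>) * Y k \<omega>) \<le> g \<omega> * (Y (Suc k) \<omega>)\<^sup>2 - g \<omega> * (Y k \<omega>)\<^sup>2"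
        using mult_left_mono[OF sqle g(2)] by (simp add: algebra_simps)
    qed (use i in auto)
    finally show ?thesis using i by simp
  qed
  \<comment> \<open>The second moments \<open>q k\<close> increase to a limit \<open>l\<close>; the
    gap \<open>l - q k\<close> will control all fluctuation of \<open>Y\<close> after time
    \<open>k\<close>.\<close>
  define q where "q k = (\<integral>\<omega>. (Y k \<omega>)\<^sup>2 \<partial>M)" for k
  have "q k \<le> q (Suc k)" for k using sqmono[of "\<lambda>_. 1" k] by (simp add: q_def)
  then have qinc: "incseq q" by (rule incseq_SucI)
  have intY2: "integrable M (\<lambda>\<omega>. (Y k \<omega>)\<^sup>2)" for k
    by (intro bint) (auto simp: Y0 Y1 power_le_one)
  have q1: "q k \<le> 1" for k
    unfolding q_def using intY2 by (intro integral_le_const) (auto simp: Y0 Y1 power_le_one)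
  obtain l where l: "q \<longlonglongrightarrow> l" "\<And>k. q k \<le> l"
    using incseq_convergent[OF qinc, of 1] q1 by blast
  \<comment> \<open>A maximal inequality of Doob-Kolmogorov type over an infinite horizon; its bound
    vanishes as \<open>k\<close> grows.\<close>
  have maximal: "prob (\<Union>j. {\<omega>\<in>space M. \<exists>i\<le>j. \<bar>Y (k + i) \<omega> - Y k \<omega>\<bar> > c}) \<le> (l - q k) / c\<^sup>2" if c: "c > 0" for k c
  proof -
    \<comment> \<open>\<open>S j\<close> is \<open>Y (k + j)\<close> frozen at the first time its
      distance to \<open>Y k\<close> exceeds \<open>c\<close>; the recursion takes the place of a
      stopping time.\<close>
    define S where "S = rec_nat (Y k) (\<lambda>j s \<omega>. if \<bar>s \<omega> - Y k \<omega>\<bar> > c then s \<omega> else Y (k + Suc j) \<omega>)"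
    have S0: "S 0 = Y k" and SS: "S (Suc j) = (\<lambda>\<omega>. if \<bar>S j \<omega> - Y k \<omega>\<bar> > c then S j \<omega> else Y (k + Suc j) \<omega>)" for j
      unfolding S_def by (simp only: nat.rec)+
    have YkF: "Y k \<in> borel_measurable (F (k + j))" for j
      by (rule measurable_filtration[where F = F, OF filt meas]) simp
    have SF: "S j \<in> borel_measurable (F (k + j))" for j
    proof (induction j)
      case 0 then show ?case using meas by (simp add: S0)
    next
      case (Suc j)
      have "S j \<in> borel_measurable (F (k + Suc j))" by (rule measurable_filtration[where F = F, OF filt Suc]) simp
      then show ?case using YkF[of "Suc j"] meas[of "k + Suc j"] unfolding SS by measurable
    qed
    have Sb: "0 \<le> S j \<omega>" "S j \<omega> \<le> 1" for j \<omega>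
      by (induction j; simp add: S0 SS Y0 Y1)+
    note [measurable] = mF[OF SF]
    have Seq: "S j \<omega> = Y (k + j) \<omega>" if "\<not> \<bar>S j \<omega> - Y k \<omega>\<bar> > c" for j \<omega>
      using that by (cases j) (auto simp: S0 SS split: if_splits)
    have Sbig: "\<bar>S j \<omega> - Y k \<omega>\<bar> > c" if "i \<le> j" "\<bar>Y (k + i) \<omega> - Y k \<omega>\<bar> > c" for i j \<omega>
      using that(1)
    proof (induction rule: dec_induct)
      case base then show ?case using that(2) Seq[of i] by force
    qed (simp add: SS)
    define I where "I j \<omega> = (if \<bar>S j \<omega> - Y k \<omega>\<bar> > c then 0 else 1 :: real)" for j \<omega>
    have IF: "I j \<in> borel_measurable (F (k + j))" for j
      using SF[of j] YkF[of j] unfolding I_def by measurable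
    have Ib: "0 \<le> I j \<omega>" "I j \<omega> \<le> 1" for j \<omega> by (auto simp: I_def)
    note [measurable] = mF[OF IF]
    note b = Y0 Y1 Sb Ib mult_le_one power_le_one mult_nonneg_nonneg zero_le_power
    have ints: "integrable M (\<lambda>\<omega>. Y k \<omega> * S j \<omega>)" "integrable M (\<lambda>\<omega>. (S j \<omega>)\<^sup>2)"
      "integrable M (\<lambda>\<omega>. (I j \<omega> * Y k \<omega>) * Y i \<omega>)" "integrable M (\<lambda>\<omega>. (1 - I j \<omega>) * (Y i \<omega>)\<^sup>2)" for j i
      by (intro bint; (measurable; fail | auto simp: b intro!: mult_le_one power_le_one))+
    \<comment> \<open>Until it is frozen, \<open>S\<close> moves like the submartingale
      \<open>Y\<close>, so testing with \<open>I j * Y k\<close> shows that the expected product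
      with \<open>Y k\<close> cannot decrease.\<close>
    have a: "q k \<le> (\<integral>\<omega>. Y k \<omega> * S j \<omega> \<partial>M)" for j
    proof (induction j)
      case 0 then show ?case by (simp add: S0 q_def power2_eq_square)
    next
      case (Suc j)
      have "(\<integral>\<omega>. (I j \<omega> * Y k \<omega>) * Y (k + j) \<omega> \<partial>M) \<le> (\<integral>\<omega>. (I j \<omega> * Y k \<omega>) * Y (Suc (k + j)) \<omega> \<partial>M)"
        using IF YkF by (intro submart borel_measurable_times b)
      then have "0 \<le> (\<integral>\<omega>. (I j \<omega> * Y k \<omega>) * Y (Suc (k + j)) \<omega> - (I j \<omega> * Y k \<omega>) * Y (k + j) \<omega> \<partial>M)"
        using ints by simp
      also have "\<dots> = (\<integral>\<omega>. Y k \<omega> * S (Suc j) \<omega> - Y k \<omega> * S j \<omega> \<partial>M)"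
        using Seq by (intro Bochner_Integration.integral_cong) (auto simp: I_def SS)
      finally show ?case using Suc ints by simp
    qed
    \<comment> \<open>Testing the squares with \<open>1 - I j\<close> shows that freezing can only
      lose second moment.\<close>
    have s: "(\<integral>\<omega>. (S j \<omega>)\<^sup>2 \<partial>M) \<le> q (k + j)" for j
    proof (induction j)
      case 0 then show ?case by (simp add: S0 q_def)
    next
      case (Suc j)
      have "(\<integral>\<omega>. (1 - I j \<omega>) * (Y (k + j) \<omega>)\<^sup>2 \<partial>M) \<le> (\<integral>\<omega>. (1 - I j \<omega>) * (Y (Suc (k + j)) \<omega>)\<^sup>2 \<partial>M)"
        using IF[of j] Ib by (intro sqmono borel_measurable_diff) auto
      then have "0 \<le> (\<integral>\<omega>. (1 - I j \<omega>) * (Y (Suc (k + j)) \<omega>)\<^sup>2 - (1 - I j \<omega>) * (Y (k + j) \<omega>)\<^sup>2 \<partial>M)"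
        using ints by simp
      also have "\<dots> = (\<integral>\<omega>. ((Y (k + Suc j) \<omega>)\<^sup>2 - (Y (k + j) \<omega>)\<^sup>2) - ((S (Suc j) \<omega>)\<^sup>2 - (S j \<omega>)\<^sup>2) \<partial>M)"
        using Seq by (intro Bochner_Integration.integral_cong) (auto simp: I_def SS)
      also have "\<dots> = (q (k + Suc j) - q (k + j)) - ((\<integral>\<omega>. (S (Suc j) \<omega>)\<^sup>2 \<partial>M) - (\<integral>\<omega>. (S j \<omega>)\<^sup>2 \<partial>M))"
        unfolding q_def using ints intY2 by simp
      finally show ?case using Suc by simp
    qed
    have one: "prob {\<omega>\<in>space M. \<exists>i\<le>j. \<bar>Y (k + i) \<omega> - Y k \<omega>\<bar> > c} \<le> (l - q k) / c\<^sup>2" for j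
    proof -
      have "prob {\<omega>\<in>space M. \<exists>i\<le>j. \<bar>Y (k + i) \<omega> - Y k \<omega>\<bar> > c} \<le> prob {\<omega>\<in>space M. c\<^sup>2 \<le> (S j \<omega> - Y k \<omega>)\<^sup>2}"
      proof (intro finite_measure_mono subsetI)
        fix \<omega> assume "\<omega> \<in> {\<omega>\<in>space M. \<exists>i\<le>j. \<bar>Y (k + i) \<omega> - Y k \<omega>\<bar> > c}"
        then have "\<omega> \<in> space M" "\<bar>S j \<omega> - Y k \<omega>\<bar> > c" using Sbig by auto
        then show "\<omega> \<in> {\<omega>\<in>space M. c\<^sup>2 \<le> (S j \<omega> - Y k \<omega>)\<^sup>2}"
          using c by (simp flip: abs_le_square_iff)
      qed measurable
      also have "\<dots> \<le> (\<integral>\<omega>. (S j \<omega> - Y k \<omega>)\<^sup>2 \<partial>M) / c\<^sup>2"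
      proof (intro integral_Markov_inequality_measure[where A="{}"])
        show "integrable M (\<lambda>\<omega>. (S j \<omega> - Y k \<omega>)\<^sup>2)"
          using ints(1,2)[of j] intY2[of k] by (simp add: power2_diff mult.commute mult.left_commute)
      qed (use c in auto)
      \<comment> \<open>By the two estimates the expanded square is at most
        \<open>q (k + j) - 2 * q k + q k\<close>.\<close>
      also have "(\<integral>\<omega>. (S j \<omega> - Y k \<omega>)\<^sup>2 \<partial>M) = (\<integral>\<omega>. (S j \<omega>)\<^sup>2 \<partial>M) - 2 * (\<integral>\<omega>. Y k \<omega> * S j \<omega> \<partial>M) + q k"
        unfolding q_def using ints(1,2)[of j] intY2[of k]
        by (simp add: power2_diff mult.commute[of "S j _"] mult.assoc)
      also have "\<dots> / c\<^sup>2 \<le> (l - q k) / c\<^sup>2"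
        using a[of j] s[of j] l(2)[of "k + j"] by (intro divide_right_mono) auto
      finally show ?thesis .
    qed
    have "(\<lambda>j. prob {\<omega>\<in>space M. \<exists>i\<le>j. \<bar>Y (k + i) \<omega> - Y k \<omega>\<bar> > c}) \<longlonglongrightarrow>
        prob (\<Union>j. {\<omega>\<in>space M. \<exists>i\<le>j. \<bar>Y (k + i) \<omega> - Y k \<omega>\<bar> > c})"
    proof (intro finite_Lim_measure_incseq)
      show "incseq (\<lambda>j. {\<omega>\<in>space M. \<exists>i\<le>j. \<bar>Y (k + i) \<omega> - Y k \<omega>\<bar> > c})"
        by (auto simp: incseq_def) (meson order.trans)
    qed auto
    then show ?thesis using one by (intro LIMSEQ_le_const2) auto
  qed
  \<comment> \<open>The event that \<open>Y\<close> leaves the band of width \<open>c\<close> around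
    \<open>Y k\<close> for every starting time \<open>k\<close> has probability at most
    \<open>(l - q k) / c^2\<close> for each \<open>k\<close>, hence zero.\<close>
  have small: "AE \<omega> in M. \<exists>k. \<forall>i. \<bar>Y (k + i) \<omega> - Y k \<omega>\<bar> \<le> c" if c: "c > 0" for c
  proof -
    let ?U = "\<lambda>k. \<Union>j. {\<omega>\<in>space M. \<exists>i\<le>j. \<bar>Y (k + i) \<omega> - Y k \<omega>\<bar> > c}"
    have [measurable]: "?U k \<in> sets M" for k by measurable
    have "prob (\<Inter>k. ?U k) \<le> (l - q k) / c\<^sup>2" for k
    proof -
      have "prob (\<Inter>k. ?U k) \<le> prob (?U k)" by (intro finite_measure_mono) auto
      then show ?thesis using maximal[OF c, of k] by linarith
    qed
    moreover have "(\<lambda>k. (l - q k) / c\<^sup>2) \<longlonglongrightarrow> (l - l) / c\<^sup>2"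
      using l(1) c by (intro tendsto_intros) auto
    ultimately have "prob (\<Inter>k. ?U k) \<le> (l - l) / c\<^sup>2" by (intro LIMSEQ_le_const) auto
    then have "prob (\<Inter>k. ?U k) = 0" by (simp add: measure_le_0_iff)
    then have "(\<Inter>k. ?U k) \<in> null_sets M" by (auto simp: emeasure_eq_measure)
    then show ?thesis by (rule AE_I') (auto simp: not_le, metis order_refl)
  qed
  have "AE \<omega> in M. \<forall>p::nat. \<exists>k. \<forall>i. \<bar>Y (k + i) \<omega> - Y k \<omega>\<bar> \<le> 1 / real (Suc p)"
    unfolding AE_all_countable using small by simp
  then show ?thesis
  proof eventually_elim
    case (elim \<omega>)
    have "Cauchy (\<lambda>k. Y k \<omega>)"
    proof (rule metric_CauchyI)
      fix r :: real assume "r > 0"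
      then obtain p :: nat where p: "1 / real (Suc p) < r / 2" using nat_approx_posE[of "r/2"] by auto
      obtain k where k: "\<And>i. \<bar>Y (k + i) \<omega> - Y k \<omega>\<bar> \<le> 1 / real (Suc p)" using elim by blast
      have near: "\<bar>Y m \<omega> - Y k \<omega>\<bar> < r / 2" if "m \<ge> k" for m
        using k[of "m - k"] p that by simp
      have "dist (Y m \<omega>) (Y m' \<omega>) < r" if "m \<ge> k" "m' \<ge> k" for m m'
        using near[OF that(1)] near[OF that(2)] unfolding dist_real_def by argo
      then show "\<exists>N. \<forall>m\<ge>N. \<forall>n\<ge>N. dist (Y m \<omega>) (Y n \<omega>) < r" by blast
    qed
    then show ?case by (rule real_Cauchy_convergent)
  qed
qed

text \<open>The bounded submartingale \<open>exp (- W)\<close> converges and its limit is positive, because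
  Fatou's lemma and the bounded expectations exclude \<open>W \<rightarrow> \<infinity>\<close>.\<close>

lemma nonneg_supermartingale_converges:
  fixes W :: "nat \<Rightarrow> 'b \<Rightarrow> real"
  assumes "prob_space M"
    and sub: "\<And>k. subalgebra M (F k)" and filt: "\<And>k. subalgebra (F (Suc k)) (F k)"
    and meas: "\<And>k. W k \<in> borel_measurable (F k)"
    and int: "\<And>k. integrable M (W k)"
    and W0: "\<And>k \<omega>. 0 \<le> W k \<omega>"
    and super: "\<And>k g. g \<in> borel_measurable (F k) \<Longrightarrow> (\<And>\<omega>. 0 \<le> g \<omega>) \<Longrightarrow> (\<And>\<omega>. g \<omega> \<le> 1)
       \<Longrightarrow> (\<integral>\<omega>. g \<omega> * W (Suc k) \<omega> \<partial>M) \<le> (\<integral>\<omega>. g \<omega> * W k \<omega> \<partial>M)"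
  shows "AE \<omega> in M. convergent (\<lambda>k. W k \<omega>)"
proof -
  interpret prob_space M by fact
  have mF: "f \<in> borel_measurable (F k) \<Longrightarrow> f \<in> borel_measurable M" for f :: "'b \<Rightarrow> real" and k
    using measurable_from_subalg[OF sub] by blast
  note [measurable] = mF[OF meas]
  have gint: "integrable M (\<lambda>\<omega>. g \<omega> * W k \<omega>)"
    if [measurable]: "g \<in> borel_measurable M" and g: "\<And>\<omega>. 0 \<le> g \<omega>" "\<And>\<omega>. g \<omega> \<le> 1" for g k
  proof (rule Bochner_Integration.integrable_bound[OF int[of k]])
    show "AE \<omega> in M. norm (g \<omega> * W k \<omega>) \<le> norm (W k \<omega>)"
      using g W0 by (auto simp: abs_mult mult_left_le_one_le)
  qed measurable
  have "AE \<omega> in M. convergent (\<lambda>k. exp (- W k \<omega>))"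
  proof (rule unit_submartingale_converges[where F = F, OF \<open>prob_space M\<close> sub filt])
    fix k and g :: "'b \<Rightarrow> real"
    assume g: "g \<in> borel_measurable (F k)" "\<And>\<omega>. 0 \<le> g \<omega>" "\<And>\<omega>. g \<omega> \<le> 1"
    have [measurable]: "g \<in> borel_measurable M" using mF g by blast
    \<comment> \<open>\<open>h\<close> lies in the unit interval because \<open>W\<close> is
      nonnegative. Testing the supermartingale with \<open>h\<close> and using
      \<open>1 + x \<le> exp x\<close> gives the submartingale property of
      \<open>exp (- W)\<close>.\<close>
    define h where "h \<omega> = g \<omega> * exp (- W k \<omega>)" for \<omega>
    have h: "h \<in> borel_measurable (F k)" "\<And>\<omega>. 0 \<le> h \<omega>" "\<And>\<omega>. h \<omega> \<le> 1"
      using g meas[of k] W0 unfolding h_def by (auto intro!: mult_le_one)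
    have [measurable]: "h \<in> borel_measurable M" using mF h by blast
    have ih: "integrable M h" using h by (intro integrable_const_bound[where B=1]) auto
    have ig: "integrable M (\<lambda>\<omega>. g \<omega> * exp (- W (Suc k) \<omega>))"
      using g W0 by (intro integrable_const_bound[where B=1]) (auto intro!: mult_le_one)
    have "(\<integral>\<omega>. h \<omega> \<partial>M) \<le> (\<integral>\<omega>. h \<omega> + h \<omega> * W k \<omega> - h \<omega> * W (Suc k) \<omega> \<partial>M)"
      using super[OF h] ih gint[OF _ h(2,3)] by simp
    also have "\<dots> \<le> (\<integral>\<omega>. g \<omega> * exp (- W (Suc k) \<omega>) \<partial>M)"
    proof (intro integral_mono)
      fix \<omega>
      have "1 + (W k \<omega> - W (Suc k) \<omega>) \<le> exp (W k \<omega> - W (Suc k) \<omega>)" by (rule exp_ge_add_one_self)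
      from mult_left_mono[OF this h(2)[of \<omega>]]
      have "h \<omega> + h \<omega> * W k \<omega> - h \<omega> * W (Suc k) \<omega> \<le> g \<omega> * (exp (- W k \<omega>) * exp (W k \<omega> - W (Suc k) \<omega>))"
        by (simp add: h_def algebra_simps)
      then show "h \<omega> + h \<omega> * W k \<omega> - h \<omega> * W (Suc k) \<omega> \<le> g \<omega> * exp (- W (Suc k) \<omega>)"
        by (simp flip: exp_add)
    qed (use ih gint[OF _ h(2,3)] ig in auto)
    finally show "(\<integral>\<omega>. g \<omega> * exp (- W k \<omega>) \<partial>M) \<le> (\<integral>\<omega>. g \<omega> * exp (- W (Suc k) \<omega>) \<partial>M)"
      by (simp add: h_def)
  qed (use W0 meas in auto)
  moreover have "AE \<omega> in M. liminf (\<lambda>k. ennreal (W k \<omega>)) < \<infinity>"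
  proof -
    have dec: "(\<integral>\<omega>. W k \<omega> \<partial>M) \<le> (\<integral>\<omega>. W 0 \<omega> \<partial>M)" for k
    proof (induction k)
      case (Suc k)
      then show ?case using super[of "\<lambda>_. 1" k] by simp
    qed simp
    have "(\<integral>\<^sup>+ \<omega>. liminf (\<lambda>k. ennreal (W k \<omega>)) \<partial>M) \<le> liminf (\<lambda>k. \<integral>\<^sup>+ \<omega>. ennreal (W k \<omega>) \<partial>M)"
      by (intro nn_integral_liminf) measurable
    also have "\<dots> \<le> ennreal (\<integral>\<omega>. W 0 \<omega> \<partial>M)"
    proof (rule Liminf_le)
      show "\<forall>\<^sub>F k in sequentially. (\<integral>\<^sup>+ \<omega>. ennreal (W k \<omega>) \<partial>M) \<le> ennreal (\<integral>\<omega>. W 0 \<omega> \<partial>M)"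
        using dec W0 int by (intro always_eventually allI) (simp add: nn_integral_eq_integral ennreal_leI)
    qed simp
    also have "\<dots> < \<infinity>" by simp
    finally have "AE \<omega> in M. liminf (\<lambda>k. ennreal (W k \<omega>)) \<noteq> \<infinity>"
      by (intro nn_integral_PInf_AE) auto
    then show ?thesis by (simp add: less_top)
  qed
  ultimately show ?thesis
  proof eventually_elim
    case (elim \<omega>)
    then obtain y where y: "(\<lambda>k. exp (- W k \<omega>)) \<longlonglongrightarrow> y" by (auto simp: convergent_def)
    have "y \<ge> 0" by (rule LIMSEQ_le_const[OF y]) auto
    moreover have "y \<noteq> 0"
    proof
      assume "y = 0"
      then have "filterlim (\<lambda>k. exp (- W k \<omega>)) (at_right 0) sequentially"
        using y by (intro tendsto_imp_filterlim_at_right) auto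
      from filterlim_compose[OF ln_at_0 this] have "filterlim (\<lambda>k. W k \<omega>) at_top sequentially"
        by (simp add: filterlim_uminus_at_top)
      then have "(\<lambda>k. ennreal (W k \<omega>)) \<longlonglongrightarrow> \<infinity>"
        by (simp add: tendsto_top_iff_ennreal filterlim_at_top_dense ennreal_less_iff)
      then show False using elim(2) by (auto dest: lim_imp_Liminf[rotated])
    qed
    ultimately have "(\<lambda>k. - ln (exp (- W k \<omega>))) \<longlonglongrightarrow> - ln y"
      using y by (intro tendsto_intros) auto
    then show ?case by (auto simp: convergent_def)
  qed
qed

lemma integrable_unit_mult:
  fixes g f :: "'b \<Rightarrow> real"
  assumes "integrable M f" "g \<in> borel_measurable M" "\<And>\<omega>. 0 \<le> g \<omega>" "\<And>\<omega>. g \<omega> \<le> 1"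
  shows "integrable M (\<lambda>\<omega>. g \<omega> * f \<omega>)"
proof (rule Bochner_Integration.integrable_bound[OF assms(1)])
  show "AE \<omega> in M. norm (g \<omega> * f \<omega>) \<le> norm (f \<omega>)"
    using assms(3,4) by (auto simp: abs_mult mult_left_le_one_le)
qed (use assms in measurable)

text \<open>Dividing by the partial products \<open>P k\<close> absorbs the factors
  \<open>1 + a k\<close>, and adding the tail \<open>\<beta> k\<close> of the series of
  \<open>b\<close> absorbs the additive errors; the result \<open>W\<close> is a nonnegative
  supermartingale. As \<open>P\<close> stays between 1 and \<open>C\<close>, neither the convergence
  of \<open>V\<close> nor the sum of \<open>U\<close> is lost.\<close>

lemma robbins_siegmund:
  fixes V U :: "nat \<Rightarrow> 'b \<Rightarrow> real" and a b :: "nat \<Rightarrow> real"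
  assumes "prob_space M"
    and sub: "\<And>k. subalgebra M (F k)" and filt: "\<And>k. subalgebra (F (Suc k)) (F k)"
    and meas: "\<And>k. V k \<in> borel_measurable (F k)"
    and V: "\<And>k. integrable M (V k)" "\<And>k \<omega>. 0 \<le> V k \<omega>"
    and U: "\<And>k. integrable M (U k)" "\<And>k \<omega>. 0 \<le> U k \<omega>"
    and a: "\<And>k. 0 \<le> a k" "summable a" and b: "\<And>k. 0 \<le> b k" "summable b"
    and step: "\<And>k g. g \<in> borel_measurable (F k) \<Longrightarrow> (\<And>\<omega>. 0 \<le> g \<omega>) \<Longrightarrow> (\<And>\<omega>. g \<omega> \<le> 1)
       \<Longrightarrow> (\<integral>\<omega>. g \<omega> * V (Suc k) \<omega> \<partial>M) + (\<integral>\<omega>. g \<omega> * U k \<omega> \<partial>M)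
          \<le> (1 + a k) * (\<integral>\<omega>. g \<omega> * V k \<omega> \<partial>M) + b k * (\<integral>\<omega>. g \<omega> \<partial>M)"
  shows "AE \<omega> in M. convergent (\<lambda>k. V k \<omega>) \<and> summable (\<lambda>k. U k \<omega>)"
proof -
  interpret prob_space M by fact
  have mF: "f \<in> borel_measurable (F k) \<Longrightarrow> f \<in> borel_measurable M" for f :: "'b \<Rightarrow> real" and k
    using measurable_from_subalg[OF sub] by blast
  define P where "P k = (\<Prod>j<k. 1 + a j)" for k
  define C where "C = exp (suminf a)"
  define \<beta> where "\<beta> k = suminf b - (\<Sum>j<k. b j)" for k
  define W where "W k \<omega> = V k \<omega> / P k + \<beta> k" for k \<omega>
  have P1: "P k \<ge> 1" for k
    unfolding P_def using a(1) by (intro prod_ge_1) auto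
  have PS: "P (Suc k) = P k * (1 + a k)" for k by (simp add: P_def)
  have PC: "P k \<le> C" for k
  proof -
    have "P k \<le> (\<Prod>j<k. exp (a j))"
      unfolding P_def using a(1) by (intro prod_mono) (auto simp: add_nonneg_nonneg)
    also have "\<dots> = exp (\<Sum>j<k. a j)" by (simp add: exp_sum)
    also have "\<dots> \<le> C" unfolding C_def using a by (simp add: sum_le_suminf)
    finally show ?thesis .
  qed
  have C: "C > 0" by (simp add: C_def)
  have \<beta>: "\<beta> k \<ge> 0" for k using b sum_le_suminf[of b "{..<k}"] by (simp add: \<beta>_def)
  have W0: "0 \<le> W k \<omega>" for k \<omega> unfolding W_def using V(2)[of k \<omega>] P1[of k] \<beta>[of k] by simp
  have Wint: "integrable M (W k)" for k unfolding W_def using V(1) by simp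
  \<comment> \<open>The bounds \<open>1 \<le> P (Suc k) \<le> C\<close> replace the weight of
    \<open>b k\<close> by 1 and the weight of the \<open>U\<close> term by
    \<open>1 / C\<close>.\<close>
  have key: "(\<integral>\<omega>. g \<omega> * W (Suc k) \<omega> \<partial>M) + (\<integral>\<omega>. g \<omega> * U k \<omega> \<partial>M) / C \<le> (\<integral>\<omega>. g \<omega> * W k \<omega> \<partial>M)"
    if g: "g \<in> borel_measurable (F k)" "\<And>\<omega>. 0 \<le> g \<omega>" "\<And>\<omega>. g \<omega> \<le> 1" for g k
  proof -
    have gM: "g \<in> borel_measurable M" using mF g by blast
    note i = integrable_unit_mult[OF _ gM g(2,3)]
    have ig: "integrable M g" using i[of "\<lambda>_. 1"] by simp
    have WV: "(\<integral>\<omega>. g \<omega> * W j \<omega> \<partial>M) = (\<integral>\<omega>. g \<omega> * V j \<omega> \<partial>M) / P j + \<beta> j * (\<integral>\<omega>. g \<omega> \<partial>M)" for j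
      unfolding W_def using i[OF V(1)[of j]] ig by (simp add: algebra_simps)
    have nU: "0 \<le> (\<integral>\<omega>. g \<omega> * U k \<omega> \<partial>M)" and ng: "0 \<le> (\<integral>\<omega>. g \<omega> \<partial>M)"
      using g U by (auto intro!: integral_nonneg_AE)
    have "(\<integral>\<omega>. g \<omega> * V (Suc k) \<omega> \<partial>M) / P (Suc k) + (\<integral>\<omega>. g \<omega> * U k \<omega> \<partial>M) / P (Suc k)
      \<le> ((1 + a k) * (\<integral>\<omega>. g \<omega> * V k \<omega> \<partial>M) + b k * (\<integral>\<omega>. g \<omega> \<partial>M)) / P (Suc k)"
      using step[OF g] P1[of "Suc k"] by (simp add: divide_right_mono flip: add_divide_distrib)
    also have "\<dots> = (\<integral>\<omega>. g \<omega> * V k \<omega> \<partial>M) / P k + b k * (\<integral>\<omega>. g \<omega> \<partial>M) / P (Suc k)"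
      using P1[of k] a(1)[of k] by (simp add: PS add_divide_distrib)
    also have "b k * (\<integral>\<omega>. g \<omega> \<partial>M) / P (Suc k) \<le> b k * (\<integral>\<omega>. g \<omega> \<partial>M) / 1"
      using P1[of "Suc k"] b(1)[of k] ng by (intro divide_left_mono) auto
    finally have 1: "(\<integral>\<omega>. g \<omega> * V (Suc k) \<omega> \<partial>M) / P (Suc k) + (\<integral>\<omega>. g \<omega> * U k \<omega> \<partial>M) / P (Suc k)
        \<le> (\<integral>\<omega>. g \<omega> * V k \<omega> \<partial>M) / P k + b k * (\<integral>\<omega>. g \<omega> \<partial>M)" by simp
    have "(\<integral>\<omega>. g \<omega> * U k \<omega> \<partial>M) / C \<le> (\<integral>\<omega>. g \<omega> * U k \<omega> \<partial>M) / P (Suc k)"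
      using PC[of "Suc k"] P1[of "Suc k"] nU C by (intro divide_left_mono) auto
    moreover have "\<beta> k * (\<integral>\<omega>. g \<omega> \<partial>M) = \<beta> (Suc k) * (\<integral>\<omega>. g \<omega> \<partial>M) + b k * (\<integral>\<omega>. g \<omega> \<partial>M)"
      by (simp add: \<beta>_def algebra_simps)
    ultimately show ?thesis using 1 unfolding WV by linarith
  qed
  have "AE \<omega> in M. convergent (\<lambda>k. W k \<omega>)"
  proof (rule nonneg_supermartingale_converges[where F = F, OF \<open>prob_space M\<close> sub filt])
    fix k and g :: "'b \<Rightarrow> real"
    assume g: "g \<in> borel_measurable (F k)" "\<And>\<omega>. 0 \<le> g \<omega>" "\<And>\<omega>. g \<omega> \<le> 1"
    have "0 \<le> (\<integral>\<omega>. g \<omega> * U k \<omega> \<partial>M) / C"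
      using g U C by (auto intro!: integral_nonneg_AE divide_nonneg_pos)
    then show "(\<integral>\<omega>. g \<omega> * W (Suc k) \<omega> \<partial>M) \<le> (\<integral>\<omega>. g \<omega> * W k \<omega> \<partial>M)" using key[OF g] by linarith
  next
    show "W k \<in> borel_measurable (F k)" for k unfolding W_def using meas[of k] by measurable
  qed (use W0 Wint in auto)
  \<comment> \<open>Telescoping \<open>key\<close> with \<open>g = 1\<close> bounds the expected
    partial sums of \<open>U\<close>; monotone convergence then makes the random sum finite almost
    surely.\<close>
  moreover have "AE \<omega> in M. (\<Sum>k. ennreal (U k \<omega>)) \<noteq> \<infinity>"
  proof (rule nn_integral_PInf_AE)
    have sum: "(\<integral>\<omega>. W m \<omega> \<partial>M) + (\<Sum>k<m. (\<integral>\<omega>. U k \<omega> \<partial>M)) / C \<le> (\<integral>\<omega>. W 0 \<omega> \<partial>M)" for m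
    proof (induction m)
      case (Suc m)
      then show ?case using key[of "\<lambda>_. 1" m] by (simp add: add_divide_distrib)
    qed simp
    have part: "(\<Sum>k<m. (\<integral>\<omega>. U k \<omega> \<partial>M)) \<le> C * (\<integral>\<omega>. W 0 \<omega> \<partial>M)" for m
    proof -
      have "0 \<le> (\<integral>\<omega>. W m \<omega> \<partial>M)" using W0 by (auto intro!: integral_nonneg_AE)
      then have "(\<Sum>k<m. (\<integral>\<omega>. U k \<omega> \<partial>M)) / C \<le> (\<integral>\<omega>. W 0 \<omega> \<partial>M)" using sum[of m] by linarith
      then show ?thesis using C by (simp add: field_simps)
    qed
    have "(\<integral>\<^sup>+ \<omega>. (\<Sum>k. ennreal (U k \<omega>)) \<partial>M) = (\<Sum>k. \<integral>\<^sup>+ \<omega>. ennreal (U k \<omega>) \<partial>M)"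
      using U by (intro nn_integral_suminf) auto
    also have "\<dots> = (\<Sum>k. ennreal (\<integral>\<omega>. U k \<omega> \<partial>M))"
      using U by (simp add: nn_integral_eq_integral)
    also have "\<dots> \<le> ennreal (C * (\<integral>\<omega>. W 0 \<omega> \<partial>M))"
    proof (rule suminf_le_const)
      fix m
      have "(\<Sum>k<m. ennreal (\<integral>\<omega>. U k \<omega> \<partial>M)) = ennreal (\<Sum>k<m. \<integral>\<omega>. U k \<omega> \<partial>M)"
        using U by (intro sum_ennreal) (auto intro!: integral_nonneg_AE)
      then show "(\<Sum>k<m. ennreal (\<integral>\<omega>. U k \<omega> \<partial>M)) \<le> ennreal (C * (\<integral>\<omega>. W 0 \<omega> \<partial>M))"
        using part[of m] by (simp add: ennreal_leI)
    qed simp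
    finally show "(\<integral>\<^sup>+ \<omega>. (\<Sum>k. ennreal (U k \<omega>)) \<partial>M) \<noteq> \<infinity>" by (auto simp: top_unique)
  qed (use U in measurable)
  ultimately show ?thesis
  proof eventually_elim
    case (elim \<omega>)
    have "summable (\<lambda>k. U k \<omega>)" using elim(2) U(2) by (intro summable_suminf_not_top) auto
    moreover have "convergent (\<lambda>k. V k \<omega>)"
    proof -
      have "incseq P" using P1 a(1) by (intro incseq_SucI) (simp add: PS algebra_simps order.trans[OF _ P1])
      then obtain p where "P \<longlonglongrightarrow> p" using incseq_convergent PC by metis
      moreover have "\<beta> \<longlonglongrightarrow> suminf b - suminf b"
        unfolding \<beta>_def using summable_LIMSEQ[OF b(2)] by (intro tendsto_intros)
      moreover obtain v where "(\<lambda>k. W k \<omega>) \<longlonglongrightarrow> v" using elim(1) by (auto simp: convergent_def)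
      ultimately have "(\<lambda>k. P k * (W k \<omega> - \<beta> k)) \<longlonglongrightarrow> p * (v - (suminf b - suminf b))"
        by (intro tendsto_intros)
      moreover have "P k * (W k \<omega> - \<beta> k) = V k \<omega>" for k using P1[of k] by (simp add: W_def)
      ultimately show ?thesis by (auto simp: convergent_def)
    qed
    ultimately show ?case by simp
  qed
qed

section \<open>Conditional moment conditions as tested integral inequalities\<close>

lemma (in prob_space) sigma_finite_subalgebraI:
  "subalgebra M F \<Longrightarrow> sigma_finite_subalgebra M F"
  by (intro finite_measure_subalgebra_is_sigma_finite finite_measure_subalgebra.intro
      finite_measure_subalgebra_axioms.intro) unfold_locales

text \<open>In each coordinate the factor \<open>inner (h \<omega>) b\<close> is measurable in the
  past and can be pulled out, which replaces the noise coordinate by its vanishing conditional mean.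
  Square integrability of both factors makes the products integrable.\<close>

lemma (in prob_space) integral_inner_cond_exp_0:
  fixes h X :: "'a \<Rightarrow> 'c::euclidean_space"
  assumes F: "subalgebra M F" and h: "h \<in> borel_measurable F" and X[measurable]: "X \<in> borel_measurable M"
    and int: "integrable M (\<lambda>\<omega>. (norm (h \<omega>))\<^sup>2)" "integrable M (\<lambda>\<omega>. (norm (X \<omega>))\<^sup>2)"
    and mean: "\<And>b. b \<in> Basis \<Longrightarrow> AE \<omega> in M. real_cond_exp M F (\<lambda>\<omega>. inner (X \<omega>) b) \<omega> = 0"
  shows "integrable M (\<lambda>\<omega>. inner (h \<omega>) (X \<omega>))" "(\<integral>\<omega>. inner (h \<omega>) (X \<omega>) \<partial>M) = 0"
proof -
  interpret S: sigma_finite_subalgebra M F using sigma_finite_subalgebraI[OF F] .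
  have [measurable]: "h \<in> borel_measurable M" using measurable_from_subalg[OF F h] .
  have hb: "(\<lambda>\<omega>. inner (h \<omega>) b) \<in> borel_measurable F" for b using h by measurable
  have i: "integrable M (\<lambda>\<omega>. inner (h \<omega>) b * inner (X \<omega>) b)" if "b \<in> Basis" for b
  proof (rule Bochner_Integration.integrable_bound[OF Bochner_Integration.integrable_add[OF int]])
    show "AE \<omega> in M. norm (inner (h \<omega>) b * inner (X \<omega>) b) \<le> norm ((norm (h \<omega>))\<^sup>2 + (norm (X \<omega>))\<^sup>2)"
    proof (intro AE_I2)
      fix \<omega>
      have "\<bar>inner (h \<omega>) b\<bar> * \<bar>inner (X \<omega>) b\<bar> \<le> norm (h \<omega>) * norm (X \<omega>)"
        using Basis_le_norm[OF that] by (intro mult_mono) auto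
      also have "\<dots> \<le> (norm (h \<omega>))\<^sup>2 + (norm (X \<omega>))\<^sup>2"
        using sum_squares_bound[of "norm (h \<omega>)" "norm (X \<omega>)"] mult_nonneg_nonneg[OF norm_ge_zero norm_ge_zero, of "h \<omega>" "X \<omega>"] by linarith
      finally show "norm (inner (h \<omega>) b * inner (X \<omega>) b) \<le> norm ((norm (h \<omega>))\<^sup>2 + (norm (X \<omega>))\<^sup>2)"
        by (simp add: abs_mult)
    qed
  qed measurable
  show "integrable M (\<lambda>\<omega>. inner (h \<omega>) (X \<omega>))"
    unfolding euclidean_inner[of "h _" "X _"] using i by (intro Bochner_Integration.integrable_sum)
  have "(\<integral>\<omega>. inner (h \<omega>) b * inner (X \<omega>) b \<partial>M) = 0" if b: "b \<in> Basis" for b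
  proof -
    have "(\<integral>\<omega>. inner (h \<omega>) b * inner (X \<omega>) b \<partial>M)
        = (\<integral>\<omega>. inner (h \<omega>) b * real_cond_exp M F (\<lambda>\<omega>. inner (X \<omega>) b) \<omega> \<partial>M)"
      using S.real_cond_exp_intg(2)[OF i[OF b] hb] by simp
    also have "\<dots> = 0" by (intro integral_eq_zero_AE) (use mean[OF b] in eventually_elim, simp)
    finally show ?thesis .
  qed
  then show "(\<integral>\<omega>. inner (h \<omega>) (X \<omega>) \<partial>M) = 0"
    unfolding euclidean_inner[of "h _" "X _"] using i by (subst Bochner_Integration.integral_sum) auto
qed

text \<open>The nonnegative conditional expectation is defined without integrability, so finiteness
  of the moment is part of the conclusion (take \<open>g = 1\<close>); for the noise this is where
  finite second moments come from.\<close>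

lemma (in prob_space) integral_le_nn_cond_exp:
  fixes X R :: "'a \<Rightarrow> real"
  assumes F: "subalgebra M F" and X[measurable]: "X \<in> borel_measurable M" and X0: "\<And>\<omega>. 0 \<le> X \<omega>"
    and R: "integrable M R" "\<And>\<omega>. 0 \<le> R \<omega>"
    and le: "AE \<omega> in M. nn_cond_exp M F (\<lambda>\<omega>. ennreal (X \<omega>)) \<omega> \<le> ennreal (R \<omega>)"
  shows "integrable M X"
    and "g \<in> borel_measurable F \<Longrightarrow> (\<And>\<omega>. 0 \<le> g \<omega>) \<Longrightarrow> (\<And>\<omega>. g \<omega> \<le> 1)
      \<Longrightarrow> (\<integral>\<omega>. g \<omega> * X \<omega> \<partial>M) \<le> (\<integral>\<omega>. g \<omega> * R \<omega> \<partial>M)"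
proof -
  interpret S: sigma_finite_subalgebra M F using sigma_finite_subalgebraI[OF F] .
  have nn: "(\<integral>\<^sup>+ \<omega>. ennreal (g \<omega> * X \<omega>) \<partial>M) \<le> ennreal (\<integral>\<omega>. g \<omega> * R \<omega> \<partial>M)"
    if g: "g \<in> borel_measurable F" "\<And>\<omega>. 0 \<le> g \<omega>" "\<And>\<omega>. g \<omega> \<le> 1" for g
  proof -
    have [measurable]: "g \<in> borel_measurable M" using measurable_from_subalg[OF F g(1)] .
    have "(\<integral>\<^sup>+ \<omega>. ennreal (g \<omega> * X \<omega>) \<partial>M) = (\<integral>\<^sup>+ \<omega>. ennreal (g \<omega>) * ennreal (X \<omega>) \<partial>M)"
      using g X0 by (simp add: ennreal_mult)
    also have "\<dots> = (\<integral>\<^sup>+ \<omega>. ennreal (g \<omega>) * nn_cond_exp M F (\<lambda>\<omega>. ennreal (X \<omega>)) \<omega> \<partial>M)"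
      using g(1) by (intro S.nn_cond_exp_intg[symmetric]) auto
    also have "\<dots> \<le> (\<integral>\<^sup>+ \<omega>. ennreal (g \<omega> * R \<omega>) \<partial>M)"
    proof (rule nn_integral_mono_AE)
      show "AE \<omega> in M. ennreal (g \<omega>) * nn_cond_exp M F (\<lambda>\<omega>. ennreal (X \<omega>)) \<omega> \<le> ennreal (g \<omega> * R \<omega>)"
        using le
      proof eventually_elim
        case (elim \<omega>)
        then show ?case using g(2) R(2) by (simp add: ennreal_mult mult_left_mono)
      qed
    qed
    also have "\<dots> = ennreal (\<integral>\<omega>. g \<omega> * R \<omega> \<partial>M)"
      using g R by (intro nn_integral_eq_integral integrable_unit_mult) auto
    finally show ?thesis .
  qed
  show iX: "integrable M X"
    using nn[of "\<lambda>_. 1"] X0 by (intro integrableI_nonneg) (auto intro: le_less_trans ennreal_less_top)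
  assume g: "g \<in> borel_measurable F" "\<And>\<omega>. 0 \<le> g \<omega>" "\<And>\<omega>. g \<omega> \<le> 1"
  have gM: "g \<in> borel_measurable M" using measurable_from_subalg[OF F g(1)] .
  have "(\<integral>\<^sup>+ \<omega>. ennreal (g \<omega> * X \<omega>) \<partial>M) = ennreal (\<integral>\<omega>. g \<omega> * X \<omega> \<partial>M)"
    using g X0 iX gM by (intro nn_integral_eq_integral integrable_unit_mult) auto
  with nn[OF g] have "ennreal (\<integral>\<omega>. g \<omega> * X \<omega> \<partial>M) \<le> ennreal (\<integral>\<omega>. g \<omega> * R \<omega> \<partial>M)" by simp
  then show "(\<integral>\<omega>. g \<omega> * X \<omega> \<partial>M) \<le> (\<integral>\<omega>. g \<omega> * R \<omega> \<partial>M)"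
    using g R by (subst (asm) ennreal_le_iff) (auto intro!: integral_nonneg_AE)
qed

text \<open>In the application \<open>V\<close> and \<open>V'\<close> are the squared distances
  before and after the step, \<open>T\<close> is the descent, \<open>F\<close> the past, and
  \<open>G\<close> the past together with \<open>eps\<close>. The linear noise terms have factors
  measurable in \<open>F\<close> and integrate to zero against \<open>g\<close>; the quadratic ones
  are replaced by their conditional bounds. Integrability of \<open>V'\<close> is concluded so that
  it can be propagated from step to step.\<close>

lemma (in prob_space) noisy_step_expectation:
  fixes eps e h1 h2 :: "'a \<Rightarrow> 'c::euclidean_space" and V V' T :: "'a \<Rightarrow> real"
  assumes F: "subalgebra M F" and G: "subalgebra M G" and FG: "subalgebra G F"
    and V: "V \<in> borel_measurable F" "integrable M V" "\<And>\<omega>. 0 \<le> V \<omega>"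
    and V'[measurable]: "V' \<in> borel_measurable M" and V'0: "\<And>\<omega>. 0 \<le> V' \<omega>"
    and T[measurable]: "T \<in> borel_measurable M" and T0: "\<And>\<omega>. 0 \<le> T \<omega>"
    and h: "h1 \<in> borel_measurable F" "h2 \<in> borel_measurable F"
    and hV: "\<And>\<omega>. (norm (h1 \<omega>))\<^sup>2 \<le> C * (1 + V \<omega>)" "\<And>\<omega>. (norm (h2 \<omega>))\<^sup>2 \<le> C * (1 + V \<omega>)"
    and noise[measurable]: "eps \<in> borel_measurable M" "e \<in> borel_measurable M"
    and eps_mean: "\<And>b. b \<in> Basis \<Longrightarrow> AE \<omega> in M. real_cond_exp M F (\<lambda>\<omega>. inner (eps \<omega>) b) \<omega> = 0"
    and e_mean: "\<And>b. b \<in> Basis \<Longrightarrow> AE \<omega> in M. real_cond_exp M F (\<lambda>\<omega>. inner (e \<omega>) b) \<omega> = 0"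
    and eps_var: "AE \<omega> in M. nn_cond_exp M F (\<lambda>\<omega>. ennreal ((norm (eps \<omega>))\<^sup>2)) \<omega> \<le> ennreal (K * (1 + V \<omega>))"
    and e_var: "AE \<omega> in M. nn_cond_exp M G (\<lambda>\<omega>. ennreal ((norm (e \<omega>))\<^sup>2)) \<omega>
        \<le> ennreal (K * (1 + V \<omega> + (norm (eps \<omega>))\<^sup>2))"
    and K: "K \<ge> 0" and c: "c \<ge> 0"
    and le: "\<And>\<omega>. V' \<omega> + T \<omega> \<le> V \<omega> + inner (h1 \<omega>) (eps \<omega>) + inner (h2 \<omega>) (e \<omega>)
        + c * (1 + V \<omega> + (norm (eps \<omega>))\<^sup>2 + (norm (e \<omega>))\<^sup>2)"
  shows "integrable M V'" "integrable M T"
    and "g \<in> borel_measurable F \<Longrightarrow> (\<And>\<omega>. 0 \<le> g \<omega>) \<Longrightarrow> (\<And>\<omega>. g \<omega> \<le> 1)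
      \<Longrightarrow> (\<integral>\<omega>. g \<omega> * V' \<omega> \<partial>M) + (\<integral>\<omega>. g \<omega> * T \<omega> \<partial>M)
        \<le> (1 + c * (1 + K)\<^sup>2) * (\<integral>\<omega>. g \<omega> * V \<omega> \<partial>M) + c * (1 + K)\<^sup>2 * (\<integral>\<omega>. g \<omega> \<partial>M)"
proof -
  have VM[measurable]: "V \<in> borel_measurable M" using measurable_from_subalg[OF F V(1)] .
  have hM[measurable]: "h1 \<in> borel_measurable M" "h2 \<in> borel_measurable M"
    using measurable_from_subalg[OF F] h by auto
  have ieps: "integrable M (\<lambda>\<omega>. (norm (eps \<omega>))\<^sup>2)"
    using V K by (intro integral_le_nn_cond_exp(1)[OF F _ _ _ _ eps_var]) auto
  \<comment> \<open>The moment of \<open>eps\<close> has to come first, since it occurs in the bound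
    for \<open>e\<close>.\<close>
  have ie: "integrable M (\<lambda>\<omega>. (norm (e \<omega>))\<^sup>2)"
    using V K ieps by (intro integral_le_nn_cond_exp(1)[OF G _ _ _ _ e_var]) auto
  have bound: "integrable M f" if "f \<in> borel_measurable M" "\<And>\<omega>. 0 \<le> f \<omega>" "\<And>\<omega>. f \<omega> \<le> r \<omega>" "integrable M r" for f r :: "'a \<Rightarrow> real"
  proof (rule Bochner_Integration.integrable_bound[OF that(4,1)], intro AE_I2)
    show "norm (f \<omega>) \<le> norm (r \<omega>)" for \<omega> using that(2,3)[of \<omega>] by simp
  qed
  have ih: "integrable M (\<lambda>\<omega>. (norm (h1 \<omega>))\<^sup>2)" "integrable M (\<lambda>\<omega>. (norm (h2 \<omega>))\<^sup>2)"
    by (rule bound[of _ "\<lambda>\<omega>. C * (1 + V \<omega>)"]; use V hV in simp)+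
  have ihe: "integrable M (\<lambda>\<omega>. inner (h1 \<omega>) (eps \<omega>))" "integrable M (\<lambda>\<omega>. inner (h2 \<omega>) (e \<omega>))"
    using integral_inner_cond_exp_0(1)[OF F h(1) _ ih(1) ieps eps_mean]
      integral_inner_cond_exp_0(1)[OF F h(2) _ ih(2) ie e_mean] by auto
  have iR: "integrable M (\<lambda>\<omega>. V \<omega> + inner (h1 \<omega>) (eps \<omega>) + inner (h2 \<omega>) (e \<omega>)
        + c * (1 + V \<omega> + (norm (eps \<omega>))\<^sup>2 + (norm (e \<omega>))\<^sup>2))"
    using V ihe ieps ie by simp
  show iV': "integrable M V'"
    by (rule bound[OF V' V'0 order.trans[OF _ le] iR]) (simp add: T0)
  show iT: "integrable M T"
    by (rule bound[OF T T0 order.trans[OF _ le] iR]) (simp add: V'0)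
  assume g: "g \<in> borel_measurable F" "\<And>\<omega>. 0 \<le> g \<omega>" "\<And>\<omega>. g \<omega> \<le> 1"
  have gM[measurable]: "g \<in> borel_measurable M" using measurable_from_subalg[OF F g(1)] .
  have gG: "g \<in> borel_measurable G" using measurable_from_subalg[OF FG g(1)] .
  note i = integrable_unit_mult[OF _ gM g(2,3)]
  have ig: "integrable M g" using i[of "\<lambda>_. 1"] by simp
  have zero: "(\<integral>\<omega>. g \<omega> * inner (h \<omega>) (X \<omega>) \<partial>M) = 0"
    if "h \<in> borel_measurable F" "X \<in> borel_measurable M" "integrable M (\<lambda>\<omega>. (norm (h \<omega>))\<^sup>2)" "integrable M (\<lambda>\<omega>. (norm (X \<omega>))\<^sup>2)"
      "\<And>b. b \<in> Basis \<Longrightarrow> AE \<omega> in M. real_cond_exp M F (\<lambda>\<omega>. inner (X \<omega>) b) \<omega> = 0"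
    for h X :: "'a \<Rightarrow> 'c"
  proof -
    have [measurable]: "h \<in> borel_measurable M" using measurable_from_subalg[OF F that(1)] .
    have "integrable M (\<lambda>\<omega>. (norm (g \<omega> *\<^sub>R h \<omega>))\<^sup>2)"
    proof (rule bound[OF _ _ _ that(3)])
      show "(norm (g \<omega> *\<^sub>R h \<omega>))\<^sup>2 \<le> (norm (h \<omega>))\<^sup>2" for \<omega>
        using g(2,3)[of \<omega>] by (intro power_mono) (auto simp: mult_left_le_one_le)
    qed auto
    with that g(1) have "(\<integral>\<omega>. inner (g \<omega> *\<^sub>R h \<omega>) (X \<omega>) \<partial>M) = 0"
      by (intro integral_inner_cond_exp_0(2)[OF F]) auto
    then show ?thesis by simp
  qed
  let ?E = "\<lambda>f. \<integral>\<omega>. g \<omega> * f \<omega> \<partial>M"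
  have eps1: "?E (\<lambda>\<omega>. (norm (eps \<omega>))\<^sup>2) \<le> K * ((\<integral>\<omega>. g \<omega> \<partial>M) + ?E V)"
  proof -
    have "?E (\<lambda>\<omega>. (norm (eps \<omega>))\<^sup>2) \<le> ?E (\<lambda>\<omega>. K * (1 + V \<omega>))"
      using V K g by (intro integral_le_nn_cond_exp(2)[OF F _ _ _ _ eps_var]) auto
    also have "\<dots> = (\<integral>\<omega>. K * (g \<omega> + g \<omega> * V \<omega>) \<partial>M)"
      by (intro Bochner_Integration.integral_cong) (auto simp: algebra_simps)
    finally show ?thesis using ig i[OF V(2)] by simp
  qed
  have e1: "?E (\<lambda>\<omega>. (norm (e \<omega>))\<^sup>2) \<le> K * ((\<integral>\<omega>. g \<omega> \<partial>M) + ?E V + ?E (\<lambda>\<omega>. (norm (eps \<omega>))\<^sup>2))"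
  proof -
    have "?E (\<lambda>\<omega>. (norm (e \<omega>))\<^sup>2) \<le> ?E (\<lambda>\<omega>. K * (1 + V \<omega> + (norm (eps \<omega>))\<^sup>2))"
      using V K g gG ieps by (intro integral_le_nn_cond_exp(2)[OF G _ _ _ _ e_var]) auto
    also have "\<dots> = (\<integral>\<omega>. K * (g \<omega> + g \<omega> * V \<omega> + g \<omega> * (norm (eps \<omega>))\<^sup>2) \<partial>M)"
      by (intro Bochner_Integration.integral_cong) (auto simp: algebra_simps)
    finally show ?thesis using ig i[OF V(2)] i[OF ieps] by simp
  qed
  have "?E V' + ?E T = (\<integral>\<omega>. g \<omega> * (V' \<omega> + T \<omega>) \<partial>M)"
    using i[OF iV'] i[OF iT] by (simp add: distrib_left)
  also have "\<dots> \<le> ?E (\<lambda>\<omega>. V \<omega> + inner (h1 \<omega>) (eps \<omega>) + inner (h2 \<omega>) (e \<omega>)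
        + c * (1 + V \<omega> + (norm (eps \<omega>))\<^sup>2 + (norm (e \<omega>))\<^sup>2))"
    using le g iV' iT iR by (intro integral_mono i mult_left_mono) auto
  also have "\<dots> = (\<integral>\<omega>. g \<omega> * V \<omega> + g \<omega> * inner (h1 \<omega>) (eps \<omega>) + g \<omega> * inner (h2 \<omega>) (e \<omega>)
        + c * (g \<omega> + g \<omega> * V \<omega> + g \<omega> * (norm (eps \<omega>))\<^sup>2 + g \<omega> * (norm (e \<omega>))\<^sup>2) \<partial>M)"
    by (intro Bochner_Integration.integral_cong) (auto simp: algebra_simps)
  also have "\<dots> = ?E V + c * ((\<integral>\<omega>. g \<omega> \<partial>M) + ?E V + ?E (\<lambda>\<omega>. (norm (eps \<omega>))\<^sup>2) + ?E (\<lambda>\<omega>. (norm (e \<omega>))\<^sup>2))"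
    using zero[OF h(1) noise(1) ih(1) ieps eps_mean] zero[OF h(2) noise(2) ih(2) ie e_mean]
      i[OF V(2)] i[OF ieps] i[OF ie] ig i[OF ihe(1)] i[OF ihe(2)] by simp
  \<comment> \<open>Inserting the bound for \<open>eps\<close> into that for \<open>e\<close> gives
    the factor \<open>1 + K + K * (1 + K)\<close>, which is \<open>(1 + K)^2\<close>.\<close>
  also have "\<dots> \<le> ?E V + c * ((1 + K)\<^sup>2 * ((\<integral>\<omega>. g \<omega> \<partial>M) + ?E V))"
  proof -
    have "K * ?E (\<lambda>\<omega>. (norm (eps \<omega>))\<^sup>2) \<le> K * (K * ((\<integral>\<omega>. g \<omega> \<partial>M) + ?E V))"
      using eps1 K by (rule mult_left_mono)
    with eps1 e1 have "(\<integral>\<omega>. g \<omega> \<partial>M) + ?E V + ?E (\<lambda>\<omega>. (norm (eps \<omega>))\<^sup>2) + ?E (\<lambda>\<omega>. (norm (e \<omega>))\<^sup>2)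
        \<le> (1 + K)\<^sup>2 * ((\<integral>\<omega>. g \<omega> \<partial>M) + ?E V)"
      by (simp add: power2_eq_square algebra_simps)
    then show ?thesis using c by (simp add: mult_left_mono)
  qed
  finally show "?E V' + ?E T \<le> (1 + c * (1 + K)\<^sup>2) * ?E V + c * (1 + K)\<^sup>2 * (\<integral>\<omega>. g \<omega> \<partial>M)"
    by (simp add: algebra_simps)
qed

section \<open>Quasi-Fejer sequences\<close>

text \<open>Since the \<open>w\<close> and the \<open>ws\<close> each sum to zero, terms in
  \<open>z\<close>, \<open>zs\<close> and \<open>c\<close> can be inserted freely into the
  first-order part of the expanded squares. This turns it into the value at the current state of the
  affine function separating it from the extended solutions, minus the value at the reference
  state.\<close>

lemma projective_step_identity:
  fixes z zs c :: "'a::real_inner" and x y w ws :: "'i \<Rightarrow> 'a"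
  assumes w: "(\<Sum>i\<in>I. w i) = 0" and ws: "(\<Sum>i\<in>I. ws i) = 0"
  shows "(norm (z - \<alpha> *\<^sub>R (\<Sum>i\<in>I. y i) - zs))\<^sup>2 + (\<Sum>i\<in>I. (norm (w i - \<alpha> *\<^sub>R (x i - c) - ws i))\<^sup>2)
    = (norm (z - zs))\<^sup>2 + (\<Sum>i\<in>I. (norm (w i - ws i))\<^sup>2)
      - 2 * \<alpha> * (\<Sum>i\<in>I. inner (z - x i) (y i - w i) + inner (x i - zs) (y i - ws i))
      + \<alpha>\<^sup>2 * ((norm (\<Sum>i\<in>I. y i))\<^sup>2 + (\<Sum>i\<in>I. (norm (x i - c))\<^sup>2))"
proof -
  have expand: "(norm (a - \<alpha> *\<^sub>R b - a'))\<^sup>2 = (norm (a - a'))\<^sup>2 - 2 * \<alpha> * inner (a - a') b + \<alpha>\<^sup>2 * (norm b)\<^sup>2"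
    for a a' b :: 'a
    unfolding power2_norm_eq_inner by (simp add: algebra_simps inner_commute power2_eq_square)
  have "inner (z - x i) (y i - w i) + inner (x i - zs) (y i - ws i)
      = inner (z - zs) (y i) + inner (w i - ws i) (x i - c) + inner (c - z) (w i) - inner (c - zs) (ws i)" for i
    by (simp add: algebra_simps inner_commute)
  then have "(\<Sum>i\<in>I. inner (z - x i) (y i - w i) + inner (x i - zs) (y i - ws i))
      = inner (z - zs) (\<Sum>i\<in>I. y i) + (\<Sum>i\<in>I. inner (w i - ws i) (x i - c))
        + inner (c - z) (\<Sum>i\<in>I. w i) - inner (c - zs) (\<Sum>i\<in>I. ws i)"
    by (simp only: sum.distrib sum_subtractf inner_sum_right)
  then have "(\<Sum>i\<in>I. inner (z - x i) (y i - w i) + inner (x i - zs) (y i - ws i))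
      = inner (z - zs) (\<Sum>i\<in>I. y i) + (\<Sum>i\<in>I. inner (w i - ws i) (x i - c))"
    by (simp add: w ws)
  moreover have "(\<Sum>i\<in>I. (norm (w i - \<alpha> *\<^sub>R (x i - c) - ws i))\<^sup>2) = (\<Sum>i\<in>I. (norm (w i - ws i))\<^sup>2)
      - 2 * \<alpha> * (\<Sum>i\<in>I. inner (w i - ws i) (x i - c)) + \<alpha>\<^sup>2 * (\<Sum>i\<in>I. (norm (x i - c))\<^sup>2)"
    unfolding expand sum.distrib sum_subtractf sum_distrib_left ..
  ultimately show ?thesis
    unfolding expand[of z] by (simp add: ring_distribs)
qed

section \<open>Squared distances of states and Opial's argument\<close>

definition sq_dist_upto :: "nat \<Rightarrow> (nat \<Rightarrow> 'a::real_normed_vector) \<Rightarrow> (nat \<Rightarrow> 'a) \<Rightarrow> real" where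
  "sq_dist_upto m p q = (\<Sum>i\<le>m. (norm (p i - q i))\<^sup>2)"

lemma sq_dist_upto_nonneg: "0 \<le> sq_dist_upto m p q"
  by (simp add: sq_dist_upto_def sum_nonneg)

lemma norm_le_sqrt_sq_dist_upto: "i \<le> m \<Longrightarrow> norm (p i - q i) \<le> sqrt (sq_dist_upto m p q)"
  unfolding sq_dist_upto_def by (intro real_le_rsqrt member_le_sum[of i "{..m}" "\<lambda>i. (norm (p i - q i))\<^sup>2"]) auto

lemma sqrt_sq_dist_upto_triangle:
  "sqrt (sq_dist_upto m p q) \<le> sqrt (sq_dist_upto m p r) + sqrt (sq_dist_upto m r q)"
proof -
  have L2: "sqrt (sq_dist_upto m p q) = L2_set (\<lambda>i. norm (p i - q i)) {..m}" for p q :: "nat \<Rightarrow> 'a"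
    by (simp add: sq_dist_upto_def L2_set_def)
  have "L2_set (\<lambda>i. norm (p i - q i)) {..m} \<le> L2_set (\<lambda>i. norm (p i - r i) + norm (r i - q i)) {..m}"
  proof (intro L2_set_mono)
    show "norm (p i - q i) \<le> norm (p i - r i) + norm (r i - q i)" for i
      using norm_triangle_ineq[of "p i - r i" "r i - q i"] by simp
  qed auto
  also have "\<dots> \<le> L2_set (\<lambda>i. norm (p i - r i)) {..m} + L2_set (\<lambda>i. norm (r i - q i)) {..m}"
    by (rule L2_set_triangle_ineq)
  finally show ?thesis by (simp only: L2)
qed

lemma sq_dist_upto_commute: "sq_dist_upto m p q = sq_dist_upto m q p"
  by (simp add: sq_dist_upto_def norm_minus_commute)

text \<open>The product topology on \<open>nat \<Rightarrow> 'a\<close> is second countable and the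
  distance, seeing finitely many coordinates, is continuous in it; one point of \<open>S\<close> is
  chosen in each basic open set that meets \<open>S\<close>. The points have to come from
  \<open>S\<close> itself, because the descent is established at extended solutions.\<close>

lemma sq_dist_upto_separable:
  fixes S :: "(nat \<Rightarrow> 'a::euclidean_space) set"
  shows "\<exists>T. countable T \<and> T \<subseteq> S \<and> (\<forall>q\<in>S. \<forall>r>0. \<exists>t\<in>T. sqrt (sq_dist_upto m t q) < r)"
proof -
  obtain \<B> :: "(nat \<Rightarrow> 'a) set set" where \<B>: "countable \<B>" "topological_basis \<B>"
    using ex_countable_basis by blast
  define T where "T = (\<lambda>b. SOME t. t \<in> b \<inter> S) ` {b \<in> \<B>. b \<inter> S \<noteq> {}}"
  have some: "(SOME t. t \<in> b \<inter> S) \<in> b \<inter> S" if "b \<inter> S \<noteq> {}" for b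
    using that someI_ex[of "\<lambda>t. t \<in> b \<inter> S"] by blast
  have "\<exists>t\<in>T. sqrt (sq_dist_upto m t q) < r" if q: "q \<in> S" and r: "r > 0" for q r
  proof -
    define O' where "O' = {t. sqrt (sq_dist_upto m t q) < r}"
    have coord: "continuous_on UNIV (\<lambda>t::nat \<Rightarrow> 'a. t i)" for i
      by (rule continuous_on_product_coordinates)
    have "continuous_on UNIV (\<lambda>t::nat \<Rightarrow> 'a. sqrt (sq_dist_upto m t q))"
      unfolding sq_dist_upto_def
      by (intro continuous_on_real_sqrt continuous_on_sum continuous_on_power continuous_on_norm
          continuous_on_diff continuous_on_const coord)
    from open_Collect_less[OF this continuous_on_const] have "open O'" unfolding O'_def .
    moreover have "q \<in> O'" using r by (simp add: O'_def sq_dist_upto_def)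
    ultimately obtain b where b: "b \<in> \<B>" "q \<in> b" "b \<subseteq> O'"
      using topological_basisE[OF \<B>(2)] by metis
    then have "b \<inter> S \<noteq> {}" using q by blast
    then have "(SOME t. t \<in> b \<inter> S) \<in> T" using b(1) unfolding T_def by blast
    moreover have "(SOME t. t \<in> b \<inter> S) \<in> O'" using some[OF \<open>b \<inter> S \<noteq> {}\<close>] b(3) by blast
    ultimately show ?thesis unfolding O'_def by blast
  qed
  moreover have "countable T" unfolding T_def using \<B>(1) by simp
  moreover have "T \<subseteq> S" unfolding T_def using some by blast
  ultimately show ?thesis by blast
qed

lemma bounded_components_convergent_subseq:
  fixes f :: "nat \<Rightarrow> nat \<Rightarrow> 'a::heine_borel"
  assumes "\<And>i. i \<le> m \<Longrightarrow> bounded (range (\<lambda>k. f k i))"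
  shows "\<exists>l r. strict_mono r \<and> (\<forall>i\<le>m. (\<lambda>k. f (r k) i) \<longlonglongrightarrow> l i)"
  using assms
proof (induction m)
  case 0
  then obtain l r where "strict_mono r" "(\<lambda>k. f (r k) 0) \<longlonglongrightarrow> l"
    using bounded_imp_convergent_subsequence[of "\<lambda>k. f k 0"] by (auto simp: o_def)
  then show ?case by (intro exI[of _ "\<lambda>_. l"] exI[of _ r]) auto
next
  case (Suc m)
  then obtain l r where r: "strict_mono r" and l: "\<And>i. i \<le> m \<Longrightarrow> (\<lambda>k. f (r k) i) \<longlonglongrightarrow> l i"
    by fastforce
  have "bounded (range (\<lambda>k. f (r k) (Suc m)))"
    using Suc.prems[of "Suc m"] by (rule bounded_subset) auto
  then obtain l' r' where r': "strict_mono r'" and l': "(\<lambda>k. f (r (r' k)) (Suc m)) \<longlonglongrightarrow> l'"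
    using bounded_imp_convergent_subsequence[of "\<lambda>k. f (r k) (Suc m)"] by (auto simp: o_def)
  have "(\<lambda>k. f ((r \<circ> r') k) i) \<longlonglongrightarrow> (l(Suc m := l')) i" if "i \<le> Suc m" for i
    using that l' LIMSEQ_subseq_LIMSEQ[OF l r', of i] by (auto simp: o_def le_Suc_eq)
  then show ?case using r r' strict_mono_o by blast
qed

text \<open>The hypothesis on cluster points concerns subsequences of \<open>r0\<close>, since the
  residual is known to vanish only there. One cluster point \<open>l\<close> in \<open>S\<close>
  suffices: the distances to \<open>l\<close> converge along the whole sequence, and their limit is
  zero because it is zero along a subsequence.\<close>

lemma opial_sq_dist_upto:
  fixes p :: "nat \<Rightarrow> nat \<Rightarrow> 'a::euclidean_space" and r0 :: "nat \<Rightarrow> nat"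
  assumes ne: "S \<noteq> {}"
    and dense: "\<And>q r. q \<in> S \<Longrightarrow> r > 0 \<Longrightarrow> \<exists>t\<in>T. sqrt (sq_dist_upto m t q) < r"
    and conv: "\<And>t. t \<in> T \<Longrightarrow> convergent (\<lambda>k. sq_dist_upto m (p k) t)"
    and r0: "strict_mono r0"
    and cluster: "\<And>(r::nat \<Rightarrow> nat) l. strict_mono r \<Longrightarrow> (\<And>i. i \<le> m \<Longrightarrow> (\<lambda>k. p (r0 (r k)) i) \<longlonglongrightarrow> l i) \<Longrightarrow> l \<in> S"
  shows "\<exists>l\<in>S. \<forall>i\<le>m. (\<lambda>k. p k i) \<longlonglongrightarrow> l i"
proof -
  let ?d = "\<lambda>p q. sqrt (sq_dist_upto m p q)"
  have lip: "\<bar>?d a q - ?d a t\<bar> \<le> ?d t q" for a q t :: "nat \<Rightarrow> 'a"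
    using sqrt_sq_dist_upto_triangle[of m a q t] sqrt_sq_dist_upto_triangle[of m a t q]
      sq_dist_upto_commute[of m q t] by simp
  \<comment> \<open>The distance is 1-Lipschitz in the reference point, so a reference in
    \<open>T\<close> within \<open>r / 3\<close> of \<open>q\<close> transfers the Cauchy
    property.\<close>
  have convS: "convergent (\<lambda>k. ?d (p k) q)" if q: "q \<in> S" for q
  proof (rule real_Cauchy_convergent, rule metric_CauchyI)
    fix r :: real assume r: "r > 0"
    then obtain t where t: "t \<in> T" "?d t q < r / 3" using dense[OF q, of "r / 3"] by auto
    obtain L where "(\<lambda>k. sq_dist_upto m (p k) t) \<longlonglongrightarrow> L" using conv[OF t(1)] by (auto simp: convergent_def)
    then have "Cauchy (\<lambda>k. ?d (p k) t)" by (rule LIMSEQ_imp_Cauchy[OF tendsto_real_sqrt])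
    from metric_CauchyD[OF this, of "r / 3"] r obtain K where
      K: "\<And>i j. i \<ge> K \<Longrightarrow> j \<ge> K \<Longrightarrow> dist (?d (p i) t) (?d (p j) t) < r / 3" by auto
    have "dist (?d (p i) q) (?d (p j) q) < r" if "i \<ge> K" "j \<ge> K" for i j
      using K[OF that] lip[of "p i" q t] lip[of "p j" q t] t(2) unfolding dist_real_def by argo
    then show "\<exists>K. \<forall>i\<ge>K. \<forall>j\<ge>K. dist (?d (p i) q) (?d (p j) q) < r" by blast
  qed
  obtain q where q: "q \<in> S" using ne by blast
  obtain R where R: "\<And>k. \<bar>?d (p k) q\<bar> \<le> R"
    using convergent_imp_Bseq[OF convS[OF q]] by (auto simp: Bseq_def)
  have "bounded (range (\<lambda>k. p (r0 k) i))" if "i \<le> m" for i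
  proof -
    have "dist (q i) (p (r0 k) i) \<le> R" for k
      using norm_le_sqrt_sq_dist_upto[OF that, of "p (r0 k)" q] R[of "r0 k"]
      by (simp add: dist_norm norm_minus_commute)
    then show ?thesis unfolding bounded_def by blast
  qed
  from bounded_components_convergent_subseq[of m "\<lambda>k. p (r0 k)", OF this]
  obtain l r where r: "strict_mono r" and l: "\<And>i. i \<le> m \<Longrightarrow> (\<lambda>k. p (r0 (r k)) i) \<longlonglongrightarrow> l i" by auto
  have lS: "l \<in> S" using cluster[OF r l] .
  obtain c where c: "(\<lambda>k. ?d (p k) l) \<longlonglongrightarrow> c" using convS[OF lS] by (auto simp: convergent_def)
  have "(\<lambda>k. ?d (p ((r0 \<circ> r) k)) l) \<longlonglongrightarrow> sqrt (\<Sum>i\<le>m. (norm (l i - l i))\<^sup>2)"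
    unfolding sq_dist_upto_def using l by (intro tendsto_intros) auto
  then have "(\<lambda>k. ?d (p ((r0 \<circ> r) k)) l) \<longlonglongrightarrow> 0" by simp
  moreover have "(\<lambda>k. ?d (p ((r0 \<circ> r) k)) l) \<longlonglongrightarrow> c"
    using LIMSEQ_subseq_LIMSEQ[OF c strict_mono_o[OF r0 r]] by (simp add: o_def)
  ultimately have "c = 0" using LIMSEQ_unique by blast
  have "(\<lambda>k. p k i) \<longlonglongrightarrow> l i" if "i \<le> m" for i
  proof (rule Lim_null_comparison[THEN Lim_null[THEN iffD2]])
    show "\<forall>\<^sub>F k in sequentially. norm (p k i - l i) \<le> ?d (p k) l"
      by (intro always_eventually allI norm_le_sqrt_sq_dist_upto that)
    show "(\<lambda>k. ?d (p k) l) \<longlonglongrightarrow> 0" using c \<open>c = 0\<close> by simp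
  qed
  then show ?thesis using lS by blast
qed

text \<open>If \<open>h\<close> stayed above some \<open>c > 0\<close> from an index on, then
  \<open>a\<close> would be dominated by \<open>a * h / c\<close> and be summable. So
  \<open>h\<close> falls below every \<open>1 / (k + 1)\<close> at arbitrarily late indices, and
  these are collected recursively.\<close>

lemma subseq_tendsto_0_of_weighted_summable:
  fixes a h :: "nat \<Rightarrow> real"
  assumes a: "\<And>k. 0 \<le> a k" "\<not> summable a" and h: "\<And>k. 0 \<le> h k" and ah: "summable (\<lambda>k. a k * h k)"
  shows "\<exists>r. strict_mono r \<and> (\<lambda>k. h (r k)) \<longlonglongrightarrow> 0"
proof -
  have inf: "\<exists>k>K. h k < c" if c: "c > 0" for c K
  proof (rule ccontr)
    assume "\<not> ?thesis"
    then have ge: "h k \<ge> c" if "k > K" for k using that not_less by blast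
    have "summable a"
    proof (rule summable_comparison_test_ev[OF _ summable_mult[OF ah, of "1 / c"]])
      show "\<forall>\<^sub>F k in sequentially. norm (a k) \<le> 1 / c * (a k * h k)"
        using eventually_gt_at_top[of K]
      proof eventually_elim
        case (elim k)
        have "a k * c \<le> a k * h k" using ge[OF elim] a(1) by (intro mult_left_mono) auto
        then show ?case using c a(1)[of k] by (simp add: field_simps)
      qed
    qed
    then show False using a(2) by simp
  qed
  have "\<exists>r. \<forall>k. h (r k) < 1 / real (Suc k) \<and> r k < r (Suc k)"
  proof (rule dependent_nat_choice)
    show "\<exists>x. h x < 1 / real (Suc 0)" using inf[of 1 0] by auto
    show "\<exists>y. h y < 1 / real (Suc (Suc k)) \<and> x < y" for x k using inf[of "1 / real (Suc (Suc k))" x] by auto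
  qed
  then obtain r where r: "\<And>k. h (r k) < 1 / real (Suc k)" "\<And>k. r k < r (Suc k)" by auto
  have "(\<lambda>k. h (r k)) \<longlonglongrightarrow> 0"
  proof (rule tendsto_sandwich[OF _ _ tendsto_const LIMSEQ_Suc[OF lim_1_over_n]])
    show "\<forall>\<^sub>F k in sequentially. h (r k) \<le> 1 / real (Suc k)" using r(1) by (simp add: less_imp_le)
  qed (simp add: h)
  then show ?thesis using r(2) strict_monoI_Suc by blast
qed

section \<open>One step of stochastic projective splitting\<close>

text \<open>A state \<open>p :: nat \<Rightarrow> 'a\<close> packs \<open>z\<close> as \<open>p 0\<close> and \<open>w\<^sub>i\<close> as \<open>p i\<close> for \<open>1 \<le> i \<le> n + 1\<close>.\<close>

locale sps =
  fixes A :: "nat \<Rightarrow> 'a::euclidean_space \<Rightarrow> 'a set" and B :: "'a \<Rightarrow> 'a"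
    and n :: nat and L tau :: real
  assumes A_mm: "\<And>i. i \<in> {1..n} \<Longrightarrow> maximal_monotone (A i)"
    and B_mono: "monotone_fun B"
    and L_pos: "L > 0"
    and B_lip: "\<And>x y. dist (B x) (B y) \<le> L * dist x y"
    and tau: "tau > 0"
begin

text \<open>The state \<open>p\<close> is passed also as the family of the \<open>w\<close>; slot 0
  holds \<open>z\<close>, and no clash arises because block indices start at 1.\<close>

abbreviation X where "X rho p eps \<equiv> sps_x A B n tau rho (p 0) p eps"
abbreviation Y where "Y rho p eps e \<equiv> sps_y A B n tau rho (p 0) p eps e"

definition extended_solution :: "(nat \<Rightarrow> 'a) \<Rightarrow> bool" where
  "extended_solution q \<longleftrightarrow>
    (\<forall>i\<in>{1..n}. q i \<in> A i (q 0)) \<and> q (n + 1) = B (q 0) \<and> (\<Sum>i=1..n+1. q i) = 0"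

text \<open>The vector inside the norm is \<open>z - x_i = tau * (y_i - w_i)\<close>. This residual
  and the forward one, taken at \<open>z\<close> and without noise, depend on the state alone, so
  they are measurable in the past and continuous in the state.\<close>

definition resolvent_residual :: "(nat \<Rightarrow> 'a) \<Rightarrow> real" where
  "resolvent_residual p = (\<Sum>i=1..n. (norm (p 0 - resolvent tau (A i) (p 0 + tau *\<^sub>R p i)))\<^sup>2)"

definition forward_residual :: "(nat \<Rightarrow> 'a) \<Rightarrow> 'a" where
  "forward_residual p = B (p 0) - p (n + 1)"

lemma is_solution_iff_extended: "is_solution A B n zs \<longleftrightarrow> (\<exists>q. extended_solution q \<and> q 0 = zs)"
proof
  assume "is_solution A B n zs"
  then obtain a where a: "\<And>i. i \<in> {1..n} \<Longrightarrow> a i \<in> A i zs" "(\<Sum>i=1..n. a i) + B zs = 0"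
    unfolding is_solution_def by blast
  define q where "q i = (if i = 0 then zs else if i = n + 1 then B zs else a i)" for i
  have "(\<Sum>i=1..n. q i) = (\<Sum>i=1..n. a i)" by (intro sum.cong) (auto simp: q_def)
  then have "extended_solution q" using a by (auto simp: extended_solution_def q_def)
  then show "\<exists>q. extended_solution q \<and> q 0 = zs" by (intro exI[of _ q]) (simp add: q_def)
next
  assume "\<exists>q. extended_solution q \<and> q 0 = zs"
  then obtain q where "extended_solution q" "q 0 = zs" by blast
  then show "is_solution A B n zs"
    unfolding is_solution_def by (intro exI[of _ q]) (auto simp: extended_solution_def)
qed

lemma norm_B_diff_le: "norm (B x - B y) \<le> L * norm (x - y)"
  using B_lip[of x y] by (simp add: dist_norm)

lemma continuous_B: "continuous_on UNIV B"
  using B_lip L_pos by (intro lipschitz_on_continuous_on[of L]) (auto simp: lipschitz_on_def)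

lemma extended_solution_resolvent:
  assumes "extended_solution q" "i \<in> {1..n}"
  shows "resolvent tau (A i) (q 0 + tau *\<^sub>R q i) = q 0"
  using assms A_mm[OF assms(2)] tau
  by (intro resolvent_unique) (auto simp: maximal_monotone_def extended_solution_def)

text \<open>The resolvent makes \<open>y_i - w_i\<close> a multiple of \<open>z - x_i\<close>, so
  the first product is an exact square; the second is nonnegative by monotonicity of
  \<open>A i\<close>, as \<open>y_i\<close> lies in \<open>A i x_i\<close>.\<close>

lemma backward_block:
  assumes q: "extended_solution q" and i: "i \<in> {1..n}"
  shows "(norm (p 0 - resolvent tau (A i) (p 0 + tau *\<^sub>R p i)))\<^sup>2 / tau
    \<le> inner (p 0 - X rho p eps i) (Y rho p eps e i - p i) + inner (X rho p eps i - q 0) (Y rho p eps e i - q i)"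
proof -
  let ?x = "resolvent tau (A i) (p 0 + tau *\<^sub>R p i)"
  have x: "X rho p eps i = ?x" and y: "Y rho p eps e i = (1 / tau) *\<^sub>R (p 0 + tau *\<^sub>R p i - ?x)"
    using i by (simp_all add: sps_x_def sps_y_def)
  have "Y rho p eps e i - p i = (1 / tau) *\<^sub>R (p 0 - ?x)"
    unfolding y using tau by (simp add: algebra_simps)
  then have "inner (p 0 - X rho p eps i) (Y rho p eps e i - p i) = (norm (p 0 - ?x))\<^sup>2 / tau"
    by (simp add: x power2_norm_eq_inner)
  moreover have "inner (Y rho p eps e i - q i) (X rho p eps i - q 0) \<ge> 0"
  proof -
    have "monotone_op (A i)" using A_mm[OF i] by (simp add: maximal_monotone_def)
    moreover have "Y rho p eps e i \<in> A i ?x" unfolding y by (rule resolvent_in[OF A_mm[OF i] tau])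
    moreover have "q i \<in> A i (q 0)" using q i by (simp add: extended_solution_def)
    ultimately show ?thesis unfolding x monotone_op_def by blast
  qed
  ultimately show ?thesis by (simp add: inner_commute)
qed

text \<open>With \<open>x\<close> the forward point, the noise \<open>e\<close> enters as
  \<open>inner (z - x) e + inner (x - q 0) e\<close>, in which \<open>x\<close>, and with it
  \<open>eps\<close>, cancels. The loss
  \<open>inner (z - x) (B z - B x) \<le> L * (norm (z - x))^2\<close>, expanded with
  \<open>z - x = rho * (u + eps)\<close>, produces the factors \<open>1 - L * rho\<close> and
  \<open>1 - 2 * L * rho\<close> and the quadratic noise term.\<close>

lemma forward_block:
  assumes q: "extended_solution q"
  shows "rho * (1 - L * rho) * (norm (forward_residual p))\<^sup>2
      + inner ((rho * (1 - 2 * L * rho)) *\<^sub>R forward_residual p) eps - L * rho\<^sup>2 * (norm eps)\<^sup>2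
      + inner (p 0 - q 0) e
    \<le> inner (p 0 - X rho p eps (n + 1)) (Y rho p eps e (n + 1) - p (n + 1))
      + inner (X rho p eps (n + 1) - q 0) (Y rho p eps e (n + 1) - q (n + 1))"
proof -
  define u where "u = forward_residual p"
  define x where "x = p 0 - rho *\<^sub>R (u + eps)"
  have x: "X rho p eps (n + 1) = x"
    unfolding x_def u_def forward_residual_def by (simp add: sps_x_def algebra_simps)
  have y: "Y rho p eps e (n + 1) = B x + e"
    unfolding x[symmetric] by (simp add: sps_y_def)
  have qB: "q (n + 1) = B (q 0)" using q by (simp add: extended_solution_def)
  have "inner (B x - B (q 0)) (x - q 0) \<ge> 0" using B_mono unfolding monotone_fun_def by blast
  then have mono: "inner (x - q 0) (B x - B (q 0)) \<ge> 0" by (simp add: inner_commute)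
  have "inner (p 0 - x) (B (p 0) - B x) \<le> norm (p 0 - x) * norm (B (p 0) - B x)"
    by (rule norm_cauchy_schwarz)
  also have "\<dots> \<le> norm (p 0 - x) * (L * norm (p 0 - x))"
    by (intro mult_left_mono norm_B_diff_le) simp
  also have "\<dots> = L * (norm (p 0 - x))\<^sup>2" by (simp add: power2_eq_square)
  finally have "inner (p 0 - x) (B (p 0) - B x) \<le> L * (norm (rho *\<^sub>R (u + eps)))\<^sup>2"
    by (simp add: x_def)
  then have "inner (p 0 - x) (B (p 0) - B x) \<le> L * rho\<^sup>2 * (norm (u + eps))\<^sup>2"
    by (simp add: power_mult_distrib)
  also have "(norm (u + eps))\<^sup>2 = (norm u)\<^sup>2 + 2 * inner u eps + (norm eps)\<^sup>2"
    by (simp add: power2_norm_eq_inner inner_left_distrib inner_right_distrib inner_commute)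
  finally have lip: "inner (p 0 - x) (B (p 0) - B x)
      \<le> L * rho\<^sup>2 * ((norm u)\<^sup>2 + 2 * inner u eps + (norm eps)\<^sup>2)" .
  have "inner (p 0 - x) u = rho * (norm u)\<^sup>2 + rho * inner u eps"
    by (simp add: x_def power2_norm_eq_inner inner_left_distrib algebra_simps inner_commute)
  moreover have "inner (p 0 - x) (B x + e - p (n + 1)) + inner (x - q 0) (B x + e - B (q 0))
      = inner (p 0 - x) u - inner (p 0 - x) (B (p 0) - B x) + inner (x - q 0) (B x - B (q 0)) + inner (p 0 - q 0) e"
    unfolding u_def forward_residual_def by (simp add: inner_diff_left inner_diff_right inner_right_distrib)
  moreover have "inner ((rho * (1 - 2 * L * rho)) *\<^sub>R u) eps = rho * inner u eps - 2 * L * rho\<^sup>2 * inner u eps"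
    by (simp add: algebra_simps power2_eq_square)
  moreover have "rho * (1 - L * rho) * (norm u)\<^sup>2 = rho * (norm u)\<^sup>2 - L * rho\<^sup>2 * (norm u)\<^sup>2"
    by (simp add: algebra_simps power2_eq_square)
  moreover have "L * rho\<^sup>2 * ((norm u)\<^sup>2 + 2 * inner u eps + (norm eps)\<^sup>2)
      = L * rho\<^sup>2 * (norm u)\<^sup>2 + 2 * L * rho\<^sup>2 * inner u eps + L * rho\<^sup>2 * (norm eps)\<^sup>2"
    by (simp add: algebra_simps)
  ultimately show ?thesis
    using lip mono unfolding x y qB u_def[symmetric] by linarith
qed

text \<open>The projective step identity combined with the block estimates; the centre
  \<open>c\<close> will be the mean of the \<open>x_i\<close>. Replacing \<open>rho\<close> by
  \<open>rhobar\<close> inside the bracket makes the coefficient of the forward residual a fixed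
  multiple of \<open>rho\<close>.\<close>

lemma sq_dist_step:
  fixes p p' q :: "nat \<Rightarrow> 'a"
  assumes q: "extended_solution q" and p: "(\<Sum>i=1..n+1. p i) = 0" and alpha: "alpha > 0"
    and rho: "0 < rho" "rho \<le> rhobar"
    and p'0: "p' 0 = p 0 - alpha *\<^sub>R (\<Sum>i=1..n+1. Y rho p eps e i)"
    and p'i: "\<And>i. i \<in> {1..n+1} \<Longrightarrow> p' i = p i - alpha *\<^sub>R (X rho p eps i - c)"
  shows "sq_dist_upto (n + 1) p' q
      + 2 * alpha * (resolvent_residual p / tau + rho * (1 - L * rhobar) * (norm (forward_residual p))\<^sup>2)
    \<le> sq_dist_upto (n + 1) p q
      + inner (- (2 * alpha * (rho * (1 - 2 * L * rho))) *\<^sub>R forward_residual p) eps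
      + inner (- (2 * alpha) *\<^sub>R (p 0 - q 0)) e + 2 * L * (alpha * rho\<^sup>2) * (norm eps)\<^sup>2
      + alpha\<^sup>2 * ((norm (\<Sum>i=1..n+1. Y rho p eps e i))\<^sup>2 + (\<Sum>i=1..n+1. (norm (X rho p eps i - c))\<^sup>2))"
proof -
  define f where "f i = inner (p 0 - X rho p eps i) (Y rho p eps e i - p i)
    + inner (X rho p eps i - q 0) (Y rho p eps e i - q i)" for i
  define u where "u = forward_residual p"
  have split: "sq_dist_upto (n + 1) r q = (norm (r 0 - q 0))\<^sup>2 + (\<Sum>i=1..n+1. (norm (r i - q i))\<^sup>2)" for r
  proof -
    have "{..n + 1} = insert 0 {1..n + 1}" by auto
    then show ?thesis by (simp add: sq_dist_upto_def del: sum.cl_ivl_Suc)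
  qed
  have q0: "(\<Sum>i=1..n+1. q i) = 0" using q unfolding extended_solution_def by blast
  have "sq_dist_upto (n + 1) p' q = (norm (p 0 - alpha *\<^sub>R (\<Sum>i=1..n+1. Y rho p eps e i) - q 0))\<^sup>2
      + (\<Sum>i=1..n+1. (norm (p i - alpha *\<^sub>R (X rho p eps i - c) - q i))\<^sup>2)"
    unfolding split p'0 using p'i by (intro arg_cong2[of _ _ _ _ "(+)"] refl sum.cong) auto
  also have "\<dots> = sq_dist_upto (n + 1) p q - 2 * alpha * (\<Sum>i=1..n+1. f i)
      + alpha\<^sup>2 * ((norm (\<Sum>i=1..n+1. Y rho p eps e i))\<^sup>2 + (\<Sum>i=1..n+1. (norm (X rho p eps i - c))\<^sup>2))"
    unfolding f_def split by (rule projective_step_identity[OF p q0])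
  finally have id: "sq_dist_upto (n + 1) p' q = \<dots>" .
  have "resolvent_residual p / tau \<le> (\<Sum>i=1..n. f i)"
    unfolding resolvent_residual_def sum_divide_distrib f_def by (intro sum_mono backward_block[OF q])
  moreover have "rho * (1 - L * rhobar) * (norm u)\<^sup>2 \<le> rho * (1 - L * rho) * (norm u)\<^sup>2"
    using rho L_pos by (intro mult_right_mono mult_left_mono) auto
  ultimately have "resolvent_residual p / tau + rho * (1 - L * rhobar) * (norm u)\<^sup>2
      + inner ((rho * (1 - 2 * L * rho)) *\<^sub>R u) eps - L * rho\<^sup>2 * (norm eps)\<^sup>2
      + inner (p 0 - q 0) e \<le> (\<Sum>i=1..n+1. f i)"
    using forward_block[OF q, of rho p eps e] unfolding f_def u_def by simp
  from mult_left_mono[OF this, of "2 * alpha"] alpha show ?thesis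
    unfolding id u_def[symmetric] by (simp add: algebra_simps)
qed

text \<open>Everything is compared with its value at \<open>q\<close>, whose component
  \<open>q 0\<close> the resolvents return: nonexpansiveness and the Lipschitz bound give affine
  growth in the distance to \<open>q\<close> and the noise. The one \<open>\<kappa>\<close> may
  depend on \<open>q\<close> and \<open>rhobar\<close> but on no state, stepsize or noise.\<close>

lemma growth:
  assumes q: "extended_solution q" and rhobar: "rhobar \<ge> 0"
  obtains \<kappa> where "\<kappa> \<ge> 0"
    and "\<And>p. (norm (forward_residual p))\<^sup>2 \<le> \<kappa> * (1 + sq_dist_upto (n + 1) p q)"
    and "\<And>p. (norm (B (p 0)))\<^sup>2 \<le> \<kappa> * (1 + sq_dist_upto (n + 1) p q)"
    and "\<And>p rho eps. 0 \<le> rho \<Longrightarrow> rho \<le> rhobar \<Longrightarrow>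
      (norm (B (X rho p eps (n + 1))))\<^sup>2 \<le> \<kappa> * (1 + sq_dist_upto (n + 1) p q + (norm eps)\<^sup>2)"
    and "\<And>p rho eps e. 0 \<le> rho \<Longrightarrow> rho \<le> rhobar \<Longrightarrow>
      (norm (\<Sum>i=1..n+1. Y rho p eps e i))\<^sup>2
        + (\<Sum>i=1..n+1. (norm (X rho p eps i - (1 / real (n + 1)) *\<^sub>R (\<Sum>j=1..n+1. X rho p eps j)))\<^sup>2)
      \<le> \<kappa> * (1 + sq_dist_upto (n + 1) p q + (norm eps)\<^sup>2 + (norm e)\<^sup>2)"
proof -
  \<comment> \<open>The constants follow the order of the estimates: \<open>W\<close> for a dual
    component, \<open>c1\<close> for the forward residual, \<open>c2\<close> for the forward point,
    \<open>c3\<close> for the resolvent blocks \<open>y_i\<close>; \<open>C\<close> is crude and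
    only has to dominate them all.\<close>
  define b where "b = norm (B (q 0))"
  define W where "W = 1 + (\<Sum>i=1..n+1. norm (q i))"
  define c1 where "c1 = b + L + W"
  define c2 where "c2 = 1 + rhobar * (c1 + 1)"
  define c3 where "c3 = W + (2 + tau) / tau"
  define C where "C = c1 + c2 + c3 + (1 + tau) + (b + L * c2 + 1)"
  define N where "N = real (n + 1)"
  have pos: "b \<ge> 0" "W \<ge> 1" "c1 \<ge> 0" "c2 \<ge> 1" "c3 \<ge> 0" "N \<ge> 1"
    using L_pos tau rhobar by (auto simp: b_def W_def c1_def c2_def c3_def N_def sum_nonneg)
  have Cpos: "C \<ge> 0" "c1 \<le> C" "c2 \<le> C" "c3 \<le> C" "1 + tau \<le> C" "b + L * c2 + 1 \<le> C" "b + L \<le> C"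
    using pos L_pos tau unfolding C_def c1_def by auto
  have qW: "norm (q i) \<le> W - 1" if "i \<in> {1..n+1}" for i
    unfolding W_def using that member_le_sum[of i "{1..n+1}" "\<lambda>i. norm (q i)"] by simp
  \<comment> \<open>The scale \<open>s p\<close> dominates every coordinate distance and is at least
    1, so additive constants are absorbed into multiples of it.\<close>
  define s where "s p = sqrt (1 + sq_dist_upto (n + 1) p q)" for p
  have s1: "s p \<ge> 1" and s2: "(s p)\<^sup>2 = 1 + sq_dist_upto (n + 1) p q" for p
    using sq_dist_upto_nonneg[of "n + 1" p q] by (auto simp: s_def)
  have d: "norm (p i - q i) \<le> s p" if "i \<le> n + 1" for p i
    using norm_le_sqrt_sq_dist_upto[OF that, of p q] unfolding s_def
    by (rule order.trans) (simp add: sq_dist_upto_nonneg)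
  have pW: "norm (p i) \<le> W * s p" if i: "i \<in> {1..n+1}" for p i
  proof -
    have "norm (p i) \<le> norm (p i - q i) + norm (q i)" by (metis add.commute norm_triangle_sub)
    also have "\<dots> \<le> s p + (W - 1) * s p"
      using d[of i p] qW[OF i] i mult_left_mono[OF s1[of p], of "W - 1"] pos by auto
    finally show ?thesis by (simp add: algebra_simps)
  qed
  have Bz: "norm (B (p 0)) \<le> (b + L) * s p" for p
  proof -
    have "norm (B (p 0)) \<le> norm (B (p 0) - B (q 0)) + b"
      unfolding b_def by (metis add.commute norm_triangle_sub)
    also have "\<dots> \<le> L * s p + b * s p"
      using norm_B_diff_le[of "p 0" "q 0"] mult_left_mono[OF d[OF le0] less_imp_le[OF L_pos], of p]
        mult_left_mono[OF s1[of p] pos(1)] by linarith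
    finally show ?thesis by (simp add: algebra_simps)
  qed
  have u: "norm (forward_residual p) \<le> c1 * s p" for p
  proof -
    have "norm (forward_residual p) \<le> norm (B (p 0)) + norm (p (n + 1))"
      unfolding forward_residual_def by (rule norm_triangle_ineq4)
    also have "\<dots> \<le> (b + L) * s p + W * s p" using Bz[of p] pW[of "n + 1" p] by simp
    finally show ?thesis by (simp add: c1_def algebra_simps)
  qed
  have xi: "norm (X rho p eps i - q 0) \<le> (1 + tau) * s p" if i: "i \<in> {1..n}" for rho p eps i
  proof -
    have "norm (X rho p eps i - q 0) = norm (resolvent tau (A i) (p 0 + tau *\<^sub>R p i) - resolvent tau (A i) (q 0 + tau *\<^sub>R q i))"
      using i by (simp add: sps_x_def extended_solution_resolvent[OF q i])
    also have "\<dots> \<le> norm ((p 0 + tau *\<^sub>R p i) - (q 0 + tau *\<^sub>R q i))"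
      by (rule resolvent_nonexpansive[OF A_mm[OF i] tau])
    also have "\<dots> = norm ((p 0 - q 0) + tau *\<^sub>R (p i - q i))" by (simp add: algebra_simps)
    also have "\<dots> \<le> norm (p 0 - q 0) + tau * norm (p i - q i)"
      using norm_triangle_ineq[of "p 0 - q 0" "tau *\<^sub>R (p i - q i)"] tau by simp
    also have "\<dots> \<le> s p + tau * s p"
      using d[of 0 p] d[of i p] i tau by (intro add_mono mult_left_mono) auto
    finally show ?thesis by (simp add: algebra_simps)
  qed
  have yi: "norm (Y rho p eps e i) \<le> c3 * s p" if i: "i \<in> {1..n}" for rho p eps e i
  proof -
    have "Y rho p eps e i = p i + (1 / tau) *\<^sub>R ((p 0 - q 0) - (X rho p eps i - q 0))"
      using i tau by (simp add: sps_y_def algebra_simps)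
    also have "norm \<dots> \<le> norm (p i) + norm ((1 / tau) *\<^sub>R ((p 0 - q 0) - (X rho p eps i - q 0)))"
      by (rule norm_triangle_ineq)
    also have "\<dots> = norm (p i) + (1 / tau) * norm ((p 0 - q 0) - (X rho p eps i - q 0))"
      using tau by simp
    also have "\<dots> \<le> W * s p + (1 / tau) * (s p + (1 + tau) * s p)"
    proof (intro add_mono mult_left_mono)
      show "norm ((p 0 - q 0) - (X rho p eps i - q 0)) \<le> s p + (1 + tau) * s p"
        by (rule order.trans[OF norm_triangle_ineq4 add_mono[OF d[OF le0] xi[OF i]]])
      show "norm (p i) \<le> W * s p" using pW i by simp
    qed (use tau in simp)
    also have "\<dots> = c3 * s p" using tau by (simp add: c3_def field_simps)
    finally show ?thesis .
  qed
  have xn: "norm (X rho p eps (n + 1) - q 0) \<le> c2 * (s p + norm eps)"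
    if rho: "0 \<le> rho" "rho \<le> rhobar" for rho p eps
  proof -
    have "X rho p eps (n + 1) - q 0 = (p 0 - q 0) - rho *\<^sub>R (forward_residual p + eps)"
      by (simp add: sps_x_def forward_residual_def algebra_simps)
    also have "norm \<dots> \<le> norm (p 0 - q 0) + rho * norm (forward_residual p + eps)"
      using norm_triangle_ineq4[of "p 0 - q 0" "rho *\<^sub>R (forward_residual p + eps)"] rho by simp
    also have "\<dots> \<le> s p + rhobar * (c1 * s p + norm eps)"
      using d[of 0 p] u[of p] rho norm_triangle_ineq[of "forward_residual p" eps]
      by (intro add_mono mult_mono) auto
    also have "\<dots> \<le> c2 * (s p + norm eps)"
      using pos s1[of p] rhobar by (simp add: c2_def algebra_simps)
    finally show ?thesis .
  qed
  have Bx: "norm (B (X rho p eps (n + 1))) \<le> (b + L * c2) * (s p + norm eps)"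
    if rho: "0 \<le> rho" "rho \<le> rhobar" for rho p eps
  proof -
    have "norm (B (X rho p eps (n + 1))) \<le> norm (B (X rho p eps (n + 1)) - B (q 0)) + b"
      unfolding b_def by (metis add.commute norm_triangle_sub)
    also have "\<dots> \<le> L * (c2 * (s p + norm eps)) + b * (s p + norm eps)"
    proof (rule add_mono)
      show "norm (B (X rho p eps (n + 1)) - B (q 0)) \<le> L * (c2 * (s p + norm eps))"
        using norm_B_diff_le[of "X rho p eps (n + 1)" "q 0"] mult_left_mono[OF xn[OF rho, of p eps], of L] L_pos
        by linarith
      have "1 \<le> s p + norm eps" using s1[of p] norm_ge_zero[of eps] by linarith
      from mult_left_mono[OF this pos(1)] show "b \<le> b * (s p + norm eps)" by simp
    qed
    finally show ?thesis by (simp add: algebra_simps)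
  qed
  have sq: "(norm v)\<^sup>2 \<le> C\<^sup>2 * r\<^sup>2" if "norm v \<le> C * r" for v :: 'a and r
    using power_mono[OF that norm_ge_zero, of 2] by (simp add: power_mult_distrib)
  have scale: "c * t \<le> C * r" if "c \<le> C" "t \<le> r" "0 \<le> t" for c t r
    using that Cpos(1) by (meson mult_left_mono mult_right_mono order.trans)
  \<comment> \<open>\<open>N^2\<close> comes from the norm of the sum of the \<open>y_i\<close>,
    \<open>4 * N\<close> from \<open>N\<close> deviations of norm at most
    \<open>2 * (C * Q)\<close>, and 3 from squaring the sum of the three terms of
    \<open>Q\<close>.\<close>
  define \<kappa> where "\<kappa> = (N\<^sup>2 + 4 * N) * (3 * C\<^sup>2)"
  have \<kappa>: "3 * C\<^sup>2 \<le> \<kappa>" "C\<^sup>2 \<le> \<kappa>"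
  proof -
    have "1 \<le> N\<^sup>2 + 4 * N" using pos(6) by (smt (verit) zero_le_power2)
    from mult_right_mono[OF this, of "3 * C\<^sup>2"] show 1: "3 * C\<^sup>2 \<le> \<kappa>" by (simp add: \<kappa>_def)
    then show "C\<^sup>2 \<le> \<kappa>" using zero_le_power2[of C] by linarith
  qed
  show thesis
  proof (rule that[of \<kappa>])
    show "\<kappa> \<ge> 0" using \<kappa>(2) zero_le_power2[of C] by linarith
    fix p :: "nat \<Rightarrow> 'a"
    have D0: "0 \<le> 1 + sq_dist_upto (n + 1) p q" using sq_dist_upto_nonneg[of "n + 1" p q] by linarith
    show "(norm (forward_residual p))\<^sup>2 \<le> \<kappa> * (1 + sq_dist_upto (n + 1) p q)"
      using sq[OF order.trans[OF u scale[OF Cpos(2) order.refl]], of p] s1[of p] mult_right_mono[OF \<kappa>(2) D0]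
      unfolding s2 by linarith
    show "(norm (B (p 0)))\<^sup>2 \<le> \<kappa> * (1 + sq_dist_upto (n + 1) p q)"
      using sq[OF order.trans[OF Bz scale[OF Cpos(7) order.refl]], of p] s1[of p] mult_right_mono[OF \<kappa>(2) D0]
      unfolding s2 by linarith
    fix rho :: real and eps :: 'a assume rho: "0 \<le> rho" "rho \<le> rhobar"
    have t0: "0 \<le> s p + norm eps" using s1[of p] norm_ge_zero[of eps] by linarith
    show "(norm (B (X rho p eps (n + 1))))\<^sup>2 \<le> \<kappa> * (1 + sq_dist_upto (n + 1) p q + (norm eps)\<^sup>2)"
    proof -
      have "b + L * c2 \<le> C" using Cpos(6) by simp
      from sq[OF order.trans[OF Bx[OF rho] scale[OF this order.refl t0]]]
      have "(norm (B (X rho p eps (n + 1))))\<^sup>2 \<le> C\<^sup>2 * (s p + norm eps)\<^sup>2" .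
      also have "\<dots> \<le> C\<^sup>2 * (2 * ((s p)\<^sup>2 + (norm eps)\<^sup>2))"
        using sum_squares_bound[of "s p" "norm eps"] by (intro mult_left_mono) (simp_all add: power2_sum)
      also have "\<dots> = 2 * C\<^sup>2 * ((s p)\<^sup>2 + (norm eps)\<^sup>2)" by simp
      also have "\<dots> \<le> \<kappa> * ((s p)\<^sup>2 + (norm eps)\<^sup>2)"
      proof (rule mult_right_mono)
        show "2 * C\<^sup>2 \<le> \<kappa>" using \<kappa>(1) zero_le_power2[of C] by linarith
      qed simp
      finally show ?thesis by (simp add: s2)
    qed
    fix e :: 'a
    define Q where "Q = s p + norm eps + norm e"
    have Q: "s p \<le> Q" "s p + norm eps \<le> Q" "Q \<ge> 0" "norm e \<le> Q" using s1[of p] by (auto simp: Q_def)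
    have yQ: "norm (Y rho p eps e i) \<le> C * Q" if "i \<in> {1..n+1}" for i
    proof (cases "i = n + 1")
      case True
      have "norm (Y rho p eps e i) = norm (B (X rho p eps (n + 1)) + e)"
        using True by (simp add: sps_y_def)
      also have "\<dots> \<le> (b + L * c2) * (s p + norm eps) + norm e"
        using norm_triangle_ineq[of "B (X rho p eps (n + 1))" e] Bx[OF rho, of p eps] by linarith
      also have "\<dots> \<le> (b + L * c2) * Q + 1 * Q"
        using Q pos L_pos by (intro add_mono mult_left_mono) auto
      also have "\<dots> \<le> C * Q"
        using mult_right_mono[OF Cpos(6) Q(3)] by (simp add: algebra_simps)
      finally show ?thesis .
    next
      case False
      then have "i \<in> {1..n}" using that by auto
      from order.trans[OF yi[OF this] scale[OF Cpos(4) Q(1)]] s1[of p] show ?thesis by simp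
    qed
    have xQ: "norm (X rho p eps i - q 0) \<le> C * Q" if "i \<in> {1..n+1}" for i
    proof (cases "i = n + 1")
      case True
      then show ?thesis using order.trans[OF xn[OF rho] scale[OF Cpos(3) Q(2) t0]] by simp
    next
      case False
      then have "i \<in> {1..n}" using that by auto
      from order.trans[OF xi[OF this] scale[OF Cpos(5) Q(1)]] s1[of p] show ?thesis by simp
    qed
    have card: "real (card {1..n+1}) = N" by (simp add: N_def)
    have sumY: "norm (\<Sum>i=1..n+1. Y rho p eps e i) \<le> N * (C * Q)"
      unfolding card[symmetric] by (intro sum_norm_bound yQ)
    have dev: "norm (X rho p eps i - (1 / N) *\<^sub>R (\<Sum>j=1..n+1. X rho p eps j)) \<le> 2 * (C * Q)"
      if i: "i \<in> {1..n+1}" for i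
    proof -
      \<comment> \<open>Shifting all \<open>x_j\<close> by \<open>q 0\<close> leaves the deviation
        from their mean unchanged, so bounds on \<open>x_j - q 0\<close> are enough.\<close>
      have shift: "(\<Sum>j=1..n+1. X rho p eps j - q 0) = (\<Sum>j=1..n+1. X rho p eps j) - N *\<^sub>R q 0"
        unfolding sum_subtractf sum_constant_scaleR card ..
      have centre: "X rho p eps i - (1 / N) *\<^sub>R (\<Sum>j=1..n+1. X rho p eps j)
          = (X rho p eps i - q 0) - (1 / N) *\<^sub>R (\<Sum>j=1..n+1. X rho p eps j - q 0)"
      proof -
        have "(1 / N) *\<^sub>R (N *\<^sub>R q 0) = q 0" using pos(6) by simp
        then have "(1 / N) *\<^sub>R (\<Sum>j=1..n+1. X rho p eps j - q 0)
            = (1 / N) *\<^sub>R (\<Sum>j=1..n+1. X rho p eps j) - q 0"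
          by (simp only: shift scaleR_diff_right)
        then show ?thesis by (simp only: diff_diff_eq2 diff_add_cancel)
      qed
      have "norm (X rho p eps i - (1 / N) *\<^sub>R (\<Sum>j=1..n+1. X rho p eps j))
          \<le> norm (X rho p eps i - q 0) + norm ((1 / N) *\<^sub>R (\<Sum>j=1..n+1. X rho p eps j - q 0))"
        unfolding centre by (rule norm_triangle_ineq4)
      also have "\<dots> = norm (X rho p eps i - q 0) + (1 / N) * norm (\<Sum>j=1..n+1. X rho p eps j - q 0)"
      proof -
        have "norm ((1 / N) *\<^sub>R v) = (1 / N) * norm v" for v :: 'a using pos(6) by simp
        then show ?thesis by (simp only:)
      qed
      also have "\<dots> \<le> C * Q + (1 / N) * (N * (C * Q))"
      proof (intro add_mono mult_left_mono xQ[OF i])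
        show "norm (\<Sum>j=1..n+1. X rho p eps j - q 0) \<le> N * (C * Q)"
          unfolding card[symmetric] by (intro sum_norm_bound xQ)
      qed (use pos(6) in simp)
      also have "\<dots> = 2 * (C * Q)" using pos(6) by simp
      finally show ?thesis .
    qed
    have "(norm (\<Sum>i=1..n+1. Y rho p eps e i))\<^sup>2 \<le> (N * (C * Q))\<^sup>2"
      using sumY by (intro power_mono) auto
    moreover have "(\<Sum>i=1..n+1. (norm (X rho p eps i - (1 / N) *\<^sub>R (\<Sum>j=1..n+1. X rho p eps j)))\<^sup>2)
        \<le> N * (2 * (C * Q))\<^sup>2"
    proof -
      show ?thesis
        unfolding card[symmetric] by (intro sum_bounded_above power_mono dev[unfolded card[symmetric]] norm_ge_zero)
    qed
    ultimately have "(norm (\<Sum>i=1..n+1. Y rho p eps e i))\<^sup>2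
        + (\<Sum>i=1..n+1. (norm (X rho p eps i - (1 / N) *\<^sub>R (\<Sum>j=1..n+1. X rho p eps j)))\<^sup>2)
      \<le> (N * (C * Q))\<^sup>2 + N * (2 * (C * Q))\<^sup>2" by (rule add_mono)
    also have "\<dots> = (N\<^sup>2 + 4 * N) * C\<^sup>2 * Q\<^sup>2"
      by (simp add: algebra_simps power_mult_distrib)
    also have "\<dots> \<le> (N\<^sup>2 + 4 * N) * C\<^sup>2 * (3 * ((s p)\<^sup>2 + (norm eps)\<^sup>2 + (norm e)\<^sup>2))"
    proof (intro mult_left_mono)
      have "(a + b + c)\<^sup>2 \<le> 3 * (a\<^sup>2 + b\<^sup>2 + c\<^sup>2)" for a b c :: real
        using sum_squares_bound[of a b] sum_squares_bound[of a c] sum_squares_bound[of b c]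
        by (simp add: power2_eq_square algebra_simps)
      then show "Q\<^sup>2 \<le> 3 * ((s p)\<^sup>2 + (norm eps)\<^sup>2 + (norm e)\<^sup>2)" unfolding Q_def .
    qed (use pos in auto)
    also have "\<dots> = \<kappa> * (1 + sq_dist_upto (n + 1) p q + (norm eps)\<^sup>2 + (norm e)\<^sup>2)"
      by (simp add: \<kappa>_def s2)
    finally show "(norm (\<Sum>i=1..n+1. Y rho p eps e i))\<^sup>2
        + (\<Sum>i=1..n+1. (norm (X rho p eps i - (1 / real (n + 1)) *\<^sub>R (\<Sum>j=1..n+1. X rho p eps j)))\<^sup>2)
      \<le> \<kappa> * (1 + sq_dist_upto (n + 1) p q + (norm eps)\<^sup>2 + (norm e)\<^sup>2)"
      unfolding N_def .
  qed
qed

text \<open>A vanishing resolvent residual says that each resolvent returns \<open>p 0\<close>, and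
  then the resolvent inclusion reads \<open>p i \<in> A i (p 0)\<close>.\<close>

lemma extended_solution_of_residuals:
  assumes "resolvent_residual p = 0" "forward_residual p = 0" "(\<Sum>i=1..n+1. p i) = 0"
  shows "extended_solution p"
proof -
  have "p i \<in> A i (p 0)" if i: "i \<in> {1..n}" for i
  proof -
    have "(norm (p 0 - resolvent tau (A i) (p 0 + tau *\<^sub>R p i)))\<^sup>2 = 0"
      using assms(1) i unfolding resolvent_residual_def by (subst (asm) sum_nonneg_eq_0_iff) auto
    then have "resolvent tau (A i) (p 0 + tau *\<^sub>R p i) = p 0" by simp
    then show ?thesis using resolvent_in[OF A_mm[OF i] tau, of "p 0 + tau *\<^sub>R p i"] tau by simp
  qed
  then show ?thesis using assms(2,3) by (simp add: extended_solution_def forward_residual_def)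
qed

lemma residuals_tendsto:
  assumes "\<And>i. i \<le> n + 1 \<Longrightarrow> (\<lambda>k. p k i) \<longlonglongrightarrow> l i"
  shows "(\<lambda>k. resolvent_residual (p k)) \<longlonglongrightarrow> resolvent_residual l"
    and "(\<lambda>k. forward_residual (p k)) \<longlonglongrightarrow> forward_residual l"
proof -
  have "(\<lambda>k. resolvent tau (A i) (p k 0 + tau *\<^sub>R p k i)) \<longlonglongrightarrow> resolvent tau (A i) (l 0 + tau *\<^sub>R l i)"
    if i: "i \<in> {1..n}" for i
  proof -
    have "(\<lambda>k. p k 0 + tau *\<^sub>R p k i) \<longlonglongrightarrow> l 0 + tau *\<^sub>R l i"
      using i assms by (intro tendsto_intros) auto
    from continuous_on_tendsto_compose[OF continuous_resolvent[OF A_mm[OF i] tau] this] show ?thesis by simp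
  qed
  then show "(\<lambda>k. resolvent_residual (p k)) \<longlonglongrightarrow> resolvent_residual l"
    unfolding resolvent_residual_def using assms by (intro tendsto_intros) auto
  show "(\<lambda>k. forward_residual (p k)) \<longlonglongrightarrow> forward_residual l"
    unfolding forward_residual_def
    using continuous_on_tendsto_compose[OF continuous_B assms[of 0]] assms[of "n + 1"]
    by (intro tendsto_diff) auto
qed

text \<open>The deterministic half, for one sample path. The zero sum of the dual components holds
  at every iterate and passes to the cluster point, which the residuals alone would not
  ensure.\<close>

lemma path_converges:
  fixes p :: "nat \<Rightarrow> nat \<Rightarrow> 'a"
  assumes ne: "\<exists>q. extended_solution q"
    and T: "T \<subseteq> Collect extended_solution"
      "\<And>q r. extended_solution q \<Longrightarrow> r > 0 \<Longrightarrow> \<exists>t\<in>T. sqrt (sq_dist_upto (n + 1) t q) < r"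
    and conv: "\<And>t. t \<in> T \<Longrightarrow> convergent (\<lambda>k. sq_dist_upto (n + 1) (p k) t)"
    and sum0: "\<And>k. (\<Sum>i=1..n+1. p k i) = 0"
    and a: "\<And>k. 0 \<le> a k" "\<not> summable a"
    and res: "summable (\<lambda>k. a k * (resolvent_residual (p k) + (norm (forward_residual (p k)))\<^sup>2))"
  shows "\<exists>zs. (\<lambda>k. p k 0) \<longlonglongrightarrow> zs \<and> is_solution A B n zs"
proof -
  have R0: "0 \<le> resolvent_residual q" for q by (simp add: resolvent_residual_def sum_nonneg)
  obtain r0 where r0: "strict_mono r0"
    and lim: "(\<lambda>k. resolvent_residual (p (r0 k)) + (norm (forward_residual (p (r0 k))))\<^sup>2) \<longlonglongrightarrow> 0"
    using subseq_tendsto_0_of_weighted_summable[OF a _ res] R0 by auto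
  have "\<exists>l\<in>Collect extended_solution. \<forall>i\<le>n + 1. (\<lambda>k. p k i) \<longlonglongrightarrow> l i"
  proof (rule opial_sq_dist_upto[OF _ _ conv r0])
    fix r :: "nat \<Rightarrow> nat" and l assume r: "strict_mono r"
      and l: "\<And>i. i \<le> n + 1 \<Longrightarrow> (\<lambda>k. p (r0 (r k)) i) \<longlonglongrightarrow> l i"
    have "(\<lambda>k. resolvent_residual (p (r0 (r k))) + (norm (forward_residual (p (r0 (r k)))))\<^sup>2)
        \<longlonglongrightarrow> resolvent_residual l + (norm (forward_residual l))\<^sup>2"
      using residuals_tendsto[of "\<lambda>k. p (r0 (r k))" l] l by (intro tendsto_intros) auto
    moreover have "(\<lambda>k. resolvent_residual (p (r0 (r k))) + (norm (forward_residual (p (r0 (r k)))))\<^sup>2) \<longlonglongrightarrow> 0"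
      using LIMSEQ_subseq_LIMSEQ[OF lim r] by (simp add: o_def)
    ultimately have "resolvent_residual l + (norm (forward_residual l))\<^sup>2 = 0"
      by (rule LIMSEQ_unique)
    then have "resolvent_residual l = 0" "forward_residual l = 0"
      using R0[of l] zero_le_power2[of "norm (forward_residual l)"] by (simp_all add: add_nonneg_eq_0_iff)
    moreover have "(\<Sum>i=1..n+1. l i) = 0"
    proof -
      have "(\<lambda>k. \<Sum>i=1..n+1. p (r0 (r k)) i) \<longlonglongrightarrow> (\<Sum>i=1..n+1. l i)"
        using l by (intro tendsto_sum) auto
      then show ?thesis unfolding sum0 by (simp add: LIMSEQ_const_iff)
    qed
    ultimately show "l \<in> Collect extended_solution" using extended_solution_of_residuals by simp
  qed (use ne T in auto)
  then show ?thesis using is_solution_iff_extended by auto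
qed

end

section \<open>Almost sure convergence\<close>

lemma subalgebra_gen_sigma:
  assumes "\<And>f. f \<in> Fs \<Longrightarrow> f \<in> borel_measurable M"
  shows "subalgebra M (gen_sigma M Fs)"
proof -
  let ?G = "\<Union>f\<in>Fs. {f -` S \<inter> space M | S. S \<in> sets borel}"
  have G: "?G \<subseteq> sets M" using assms measurable_sets by blast
  then have "?G \<subseteq> Pow (space M)" using sets.space_closed by blast
  then show ?thesis
    unfolding subalgebra_def gen_sigma_def
    using sets.sigma_sets_subset[OF G] by (simp add: space_measure_of_conv)
qed

lemma measurable_gen_sigma:
  fixes f :: "'b \<Rightarrow> 'c::topological_space"
  assumes "f \<in> Fs"
  shows "f \<in> borel_measurable (gen_sigma M Fs)"
proof (rule measurableI)
  let ?G = "\<Union>f\<in>Fs. {f -` S \<inter> space M | S. S \<in> sets borel}"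
  have sub: "?G \<subseteq> Pow (space M)" by auto
  fix S :: "'c set" assume "S \<in> sets borel"
  then have "f -` S \<inter> space M \<in> ?G" using assms by blast
  then show "f -` S \<inter> space (gen_sigma M Fs) \<in> sets (gen_sigma M Fs)"
    using sub by (simp add: gen_sigma_def sigma_sets.Basic)
qed simp

lemma subalgebra_gen_sigma_mono:
  fixes Fs Gs :: "('a \<Rightarrow> 'b::topological_space) set"
  assumes "Fs \<subseteq> Gs"
  shows "subalgebra (gen_sigma M Gs) (gen_sigma M Fs)"
proof -
  let ?G = "\<lambda>Fs. \<Union>f\<in>Fs. {f -` S \<inter> space M | S. S \<in> sets borel}"
  have "?G Fs \<subseteq> ?G Gs" using assms by blast
  then have "sigma_sets (space M) (?G Fs) \<subseteq> sigma_sets (space M) (?G Gs)" by (rule sigma_sets_mono')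
  moreover have "?G Hs \<subseteq> Pow (space M)" for Hs :: "('a \<Rightarrow> 'b) set" by auto
  ultimately show ?thesis
    unfolding subalgebra_def gen_sigma_def by (simp add: space_measure_of_conv)
qed

text \<open>Robbins-Siegmund applied to the squared distance to one fixed \<open>q\<close>, with
  time starting at 0 and \<open>G k\<close> standing for the past together with
  \<open>eps k\<close>. The null set may depend on \<open>q\<close>, whereas the residual series in
  the conclusion does not involve \<open>q\<close>.\<close>

lemma (in sps) AE_quasi_fejer:
  fixes p :: "nat \<Rightarrow> 'b \<Rightarrow> nat \<Rightarrow> 'a" and eps e :: "nat \<Rightarrow> 'b \<Rightarrow> 'a"
    and F G :: "nat \<Rightarrow> 'b measure" and alpha rho :: "nat \<Rightarrow> real"
  assumes P: "prob_space M"
    and F: "\<And>k. subalgebra M (F k)" "\<And>k. subalgebra (F (Suc k)) (F k)"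
    and G: "\<And>k. subalgebra M (G k)" "\<And>k. subalgebra (G k) (F k)"
    and pF: "\<And>k i. i \<le> n + 1 \<Longrightarrow> (\<lambda>\<omega>. p k \<omega> i) \<in> borel_measurable (F k)"
    and noise: "\<And>k. eps k \<in> borel_measurable M" "\<And>k. e k \<in> borel_measurable M"
    and p_init: "\<And>i \<omega>. i \<le> n + 1 \<Longrightarrow> p 0 \<omega> i = p0 i"
    and p_sum: "\<And>k \<omega>. (\<Sum>i=1..n+1. p k \<omega> i) = 0"
    and z_step: "\<And>k \<omega>. p (Suc k) \<omega> 0
      = p k \<omega> 0 - alpha k *\<^sub>R (\<Sum>i=1..n+1. Y (rho k) (p k \<omega>) (eps k \<omega>) (e k \<omega>) i)"
    and w_step: "\<And>k \<omega> i. i \<in> {1..n+1} \<Longrightarrow> p (Suc k) \<omega> i = p k \<omega> i - alpha k *\<^sub>R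
      (X (rho k) (p k \<omega>) (eps k \<omega>) i - (1 / real (n + 1)) *\<^sub>R (\<Sum>j=1..n+1. X (rho k) (p k \<omega>) (eps k \<omega>) j))"
    and eps_mean: "\<And>k b. b \<in> Basis \<Longrightarrow> AE \<omega> in M. real_cond_exp M (F k) (\<lambda>\<omega>. inner (eps k \<omega>) b) \<omega> = 0"
    and e_mean: "\<And>k b. b \<in> Basis \<Longrightarrow> AE \<omega> in M. real_cond_exp M (F k) (\<lambda>\<omega>. inner (e k \<omega>) b) \<omega> = 0"
    and N_nonneg: "N1 \<ge> 0" "N2 \<ge> 0" "N3 \<ge> 0" "N4 \<ge> 0"
    and eps_var: "\<And>k. AE \<omega> in M. nn_cond_exp M (F k) (\<lambda>\<omega>. ennreal ((norm (eps k \<omega>))\<^sup>2)) \<omega>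
          \<le> ennreal (N1 + N2 * (norm (B (p k \<omega> 0)))\<^sup>2)"
    and e_var: "\<And>k. AE \<omega> in M. nn_cond_exp M (G k) (\<lambda>\<omega>. ennreal ((norm (e k \<omega>))\<^sup>2)) \<omega>
          \<le> ennreal (N3 + N4 * (norm (B (X (rho k) (p k \<omega>) (eps k \<omega>) (n + 1))))\<^sup>2)"
    and alpha: "\<And>k. alpha k > 0" and rho: "\<And>k. rho k > 0" "\<And>k. rho k \<le> rhobar" and rhobar: "L * rhobar < 1"
    and sums: "summable (\<lambda>k. (alpha k)\<^sup>2)" "summable (\<lambda>k. alpha k * (rho k)\<^sup>2)"
    and q: "extended_solution q"
  shows "AE \<omega> in M. convergent (\<lambda>k. sq_dist_upto (n + 1) (p k \<omega>) q) \<and>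
    summable (\<lambda>k. 2 * alpha k * (resolvent_residual (p k \<omega>) / tau
      + rho k * (1 - L * rhobar) * (norm (forward_residual (p k \<omega>)))\<^sup>2))"
proof -
  interpret prob_space M by fact
  have rhobar0: "rhobar \<ge> 0" using rho[of 0] by linarith
  obtain \<kappa> where \<kappa>: "\<kappa> \<ge> 0"
    and g_u: "\<And>p. (norm (forward_residual p))\<^sup>2 \<le> \<kappa> * (1 + sq_dist_upto (n + 1) p q)"
    and g_B: "\<And>p. (norm (B (p 0)))\<^sup>2 \<le> \<kappa> * (1 + sq_dist_upto (n + 1) p q)"
    and g_Bx: "\<And>p rho eps. 0 \<le> rho \<Longrightarrow> rho \<le> rhobar \<Longrightarrow>
      (norm (B (X rho p eps (n + 1))))\<^sup>2 \<le> \<kappa> * (1 + sq_dist_upto (n + 1) p q + (norm eps)\<^sup>2)"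
    and g_G: "\<And>p rho eps e. 0 \<le> rho \<Longrightarrow> rho \<le> rhobar \<Longrightarrow>
      (norm (\<Sum>i=1..n+1. Y rho p eps e i))\<^sup>2
        + (\<Sum>i=1..n+1. (norm (X rho p eps i - (1 / real (n + 1)) *\<^sub>R (\<Sum>j=1..n+1. X rho p eps j)))\<^sup>2)
      \<le> \<kappa> * (1 + sq_dist_upto (n + 1) p q + (norm eps)\<^sup>2 + (norm e)\<^sup>2)"
    by (rule growth[OF q rhobar0]) (rule that; blast)
  define V where "V k \<omega> = sq_dist_upto (n + 1) (p k \<omega>) q" for k \<omega>
  define T where "T k \<omega> = 2 * alpha k * (resolvent_residual (p k \<omega>) / tau
      + rho k * (1 - L * rhobar) * (norm (forward_residual (p k \<omega>)))\<^sup>2)" for k \<omega>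
  \<comment> \<open>\<open>\<kappa> * (alpha k)^2\<close> pays for the second-order term and
    \<open>2 * L * alpha k * (rho k)^2\<close> for the noise in the forward point; the factored form
    only adds two nonnegative products. \<open>K\<close> likewise merges both variance bounds once
    they are expressed through \<open>V\<close>.\<close>
  define c where "c k = (\<kappa> + 2 * L) * ((alpha k)\<^sup>2 + alpha k * (rho k)\<^sup>2)" for k
  define K where "K = N1 + N2 * \<kappa> + (N3 + N4 * \<kappa>)"
  define s where "s k = 2 * alpha k * (rho k * (1 - 2 * L * rho k))" for k
  have V0: "0 \<le> V k \<omega>" for k \<omega> by (simp add: V_def sq_dist_upto_nonneg)
  have R0: "0 \<le> resolvent_residual r" for r by (simp add: resolvent_residual_def sum_nonneg)
  have T0: "0 \<le> T k \<omega>" for k \<omega>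
    unfolding T_def using alpha[of k] rho[of k] rhobar tau R0 by (simp add: less_imp_le)
  have c0: "0 \<le> c k" for k unfolding c_def using \<kappa> L_pos alpha[of k] by simp
  have K0: "0 \<le> K" unfolding K_def using N_nonneg \<kappa> by simp
  have VF: "V k \<in> borel_measurable (F k)" for k
    unfolding V_def sq_dist_upto_def using pF[of _ k] by measurable
  have resM: "(\<lambda>\<omega>. resolvent_residual (p k \<omega>)) \<in> borel_measurable (F k)" for k
  proof -
    have "(\<lambda>\<omega>. resolvent tau (A i) (p k \<omega> 0 + tau *\<^sub>R p k \<omega> i)) \<in> borel_measurable (F k)" if i: "i \<in> {1..n}" for i
      using i pF[of 0 k] pF[of i k]
      by (intro measurable_compose[OF _ borel_measurable_continuous_onI[OF continuous_resolvent[OF A_mm[OF i] tau]]]) auto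
    then show ?thesis unfolding resolvent_residual_def using pF[of 0 k] by measurable
  qed
  have fwdM: "(\<lambda>\<omega>. forward_residual (p k \<omega>)) \<in> borel_measurable (F k)" for k
    unfolding forward_residual_def using pF[of 0 k] pF[of "n + 1" k]
    by (intro borel_measurable_diff measurable_compose[OF _ borel_measurable_continuous_onI[OF continuous_B]]) auto
  have TM: "T k \<in> borel_measurable M" for k
    by (rule measurable_from_subalg[OF F(1)[of k]]) (use resM[of k] fwdM[of k] in \<open>unfold T_def, measurable\<close>)
  have VM: "V k \<in> borel_measurable M" for k
    by (rule measurable_from_subalg[OF F(1) VF])
  \<comment> \<open>Assumes integrability of the current distance, which the step itself passes on;
    the induction starts from the deterministic initial state.\<close>
  have one_step: "integrable M (V (Suc k))" "integrable M (T k)"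
    "g \<in> borel_measurable (F k) \<Longrightarrow> (\<And>\<omega>. 0 \<le> g \<omega>) \<Longrightarrow> (\<And>\<omega>. g \<omega> \<le> 1) \<Longrightarrow>
      (\<integral>\<omega>. g \<omega> * V (Suc k) \<omega> \<partial>M) + (\<integral>\<omega>. g \<omega> * T k \<omega> \<partial>M)
        \<le> (1 + c k * (1 + K)\<^sup>2) * (\<integral>\<omega>. g \<omega> * V k \<omega> \<partial>M) + c k * (1 + K)\<^sup>2 * (\<integral>\<omega>. g \<omega> \<partial>M)"
    if Vint: "integrable M (V k)" for k g
  proof -
    define h1 where "h1 \<omega> = - s k *\<^sub>R forward_residual (p k \<omega>)" for \<omega>
    define h2 where "h2 \<omega> = - (2 * alpha k) *\<^sub>R (p k \<omega> 0 - q 0)" for \<omega>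
    define C where "C = (s k)\<^sup>2 * \<kappa> + (2 * alpha k)\<^sup>2"
    have h: "h1 \<in> borel_measurable (F k)" "h2 \<in> borel_measurable (F k)"
      unfolding h1_def h2_def using fwdM[of k] pF[of 0 k] by measurable
    have h1C: "(norm (h1 \<omega>))\<^sup>2 \<le> C * (1 + V k \<omega>)" for \<omega>
    proof -
      have "(norm (h1 \<omega>))\<^sup>2 = (s k)\<^sup>2 * (norm (forward_residual (p k \<omega>)))\<^sup>2"
        by (simp add: h1_def power_mult_distrib)
      also have "\<dots> \<le> (s k)\<^sup>2 * (\<kappa> * (1 + V k \<omega>))"
        unfolding V_def by (intro mult_left_mono g_u) simp
      also have "\<dots> \<le> C * (1 + V k \<omega>)"
        using V0[of k \<omega>] by (simp add: C_def algebra_simps)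
      finally show ?thesis .
    qed
    have h2C: "(norm (h2 \<omega>))\<^sup>2 \<le> C * (1 + V k \<omega>)" for \<omega>
    proof -
      have "norm (p k \<omega> 0 - q 0) \<le> sqrt (V k \<omega>)"
        unfolding V_def by (rule norm_le_sqrt_sq_dist_upto) simp
      then have "(norm (p k \<omega> 0 - q 0))\<^sup>2 \<le> 1 + V k \<omega>"
        using power_mono[OF _ norm_ge_zero, of "p k \<omega> 0 - q 0" "sqrt (V k \<omega>)" 2] V0[of k \<omega>] by simp
      then have "(2 * alpha k)\<^sup>2 * (norm (p k \<omega> 0 - q 0))\<^sup>2 \<le> (2 * alpha k)\<^sup>2 * (1 + V k \<omega>)"
        by (intro mult_left_mono) auto
      also have "\<dots> \<le> C * (1 + V k \<omega>)"
        unfolding C_def using V0[of k \<omega>] \<kappa> by (intro mult_right_mono) auto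
      finally show ?thesis by (simp add: h2_def power_mult_distrib)
    qed
    have var1: "AE \<omega> in M. nn_cond_exp M (F k) (\<lambda>\<omega>. ennreal ((norm (eps k \<omega>))\<^sup>2)) \<omega> \<le> ennreal (K * (1 + V k \<omega>))"
      using eps_var[of k]
    proof eventually_elim
      case (elim \<omega>)
      have "N2 * (norm (B (p k \<omega> 0)))\<^sup>2 \<le> N2 * (\<kappa> * (1 + V k \<omega>))"
        unfolding V_def using N_nonneg by (intro mult_left_mono g_B)
      moreover have "N1 * 1 \<le> N1 * (1 + V k \<omega>)"
        by (rule mult_left_mono) (use V0[of k \<omega>] N_nonneg in auto)
      moreover have "0 \<le> (N3 + N4 * \<kappa>) * (1 + V k \<omega>)"
        using V0[of k \<omega>] N_nonneg \<kappa> by simp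
      ultimately have "N1 + N2 * (norm (B (p k \<omega> 0)))\<^sup>2 \<le> K * (1 + V k \<omega>)"
        unfolding K_def by (simp add: ring_distribs)
      then show ?case using elim by (meson ennreal_leI order.trans)
    qed
    have var2: "AE \<omega> in M. nn_cond_exp M (G k) (\<lambda>\<omega>. ennreal ((norm (e k \<omega>))\<^sup>2)) \<omega>
        \<le> ennreal (K * (1 + V k \<omega> + (norm (eps k \<omega>))\<^sup>2))"
      using e_var[of k]
    proof eventually_elim
      case (elim \<omega>)
      let ?S = "1 + V k \<omega> + (norm (eps k \<omega>))\<^sup>2"
      have "N4 * (norm (B (X (rho k) (p k \<omega>) (eps k \<omega>) (n + 1))))\<^sup>2 \<le> N4 * (\<kappa> * ?S)"
        unfolding V_def using N_nonneg rho[of k] by (intro mult_left_mono g_Bx) auto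
      moreover have "N3 * 1 \<le> N3 * ?S"
        by (rule mult_left_mono) (use V0[of k \<omega>] N_nonneg in auto)
      moreover have "0 \<le> (N1 + N2 * \<kappa>) * ?S"
        using V0[of k \<omega>] N_nonneg \<kappa> by simp
      ultimately have "N3 + N4 * (norm (B (X (rho k) (p k \<omega>) (eps k \<omega>) (n + 1))))\<^sup>2 \<le> K * ?S"
        unfolding K_def by (simp add: distrib_right[of _ _ ?S] mult.assoc)
      then show ?case using elim by (meson ennreal_leI order.trans)
    qed
    have le: "V (Suc k) \<omega> + T k \<omega> \<le> V k \<omega> + inner (h1 \<omega>) (eps k \<omega>) + inner (h2 \<omega>) (e k \<omega>)
        + c k * (1 + V k \<omega> + (norm (eps k \<omega>))\<^sup>2 + (norm (e k \<omega>))\<^sup>2)" for \<omega>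
    proof -
      let ?S = "1 + V k \<omega> + (norm (eps k \<omega>))\<^sup>2 + (norm (e k \<omega>))\<^sup>2"
      let ?a = "(alpha k)\<^sup>2" and ?b = "alpha k * (rho k)\<^sup>2"
      define Q where "Q = (norm (\<Sum>i=1..n+1. Y (rho k) (p k \<omega>) (eps k \<omega>) (e k \<omega>) i))\<^sup>2
        + (\<Sum>i=1..n+1. (norm (X (rho k) (p k \<omega>) (eps k \<omega>) i
            - (1 / real (n + 1)) *\<^sub>R (\<Sum>j=1..n+1. X (rho k) (p k \<omega>) (eps k \<omega>) j)))\<^sup>2)"
      have step: "V (Suc k) \<omega> + T k \<omega> \<le> V k \<omega> + inner (h1 \<omega>) (eps k \<omega>) + inner (h2 \<omega>) (e k \<omega>)
          + 2 * L * ?b * (norm (eps k \<omega>))\<^sup>2 + ?a * Q"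
        unfolding V_def T_def h1_def h2_def s_def Q_def
        by (rule sq_dist_step[OF q p_sum alpha rho z_step w_step])
      have S: "0 \<le> ?S" "(norm (eps k \<omega>))\<^sup>2 \<le> ?S"
        using V0[of k \<omega>] zero_le_power2[of "norm (eps k \<omega>)"] zero_le_power2[of "norm (e k \<omega>)"] by linarith+
      have b0: "0 \<le> 2 * L * ?b" using L_pos alpha[of k] by simp
      have "?a * Q \<le> ?a * (\<kappa> * ?S)"
        unfolding Q_def V_def using rho[of k] by (intro mult_left_mono g_G) auto
      moreover have "2 * L * ?b * (norm (eps k \<omega>))\<^sup>2 \<le> 2 * L * ?b * ?S"
        using S(2) b0 by (rule mult_left_mono)
      moreover have "0 \<le> \<kappa> * ?b * ?S" "0 \<le> 2 * L * ?a * ?S"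
        using S(1) \<kappa> L_pos alpha[of k] by (auto intro!: mult_nonneg_nonneg)
      moreover have "c k * ?S = ?a * (\<kappa> * ?S) + 2 * L * ?b * ?S + \<kappa> * ?b * ?S + 2 * L * ?a * ?S"
        unfolding c_def by (simp only: distrib_right distrib_left) (simp only: mult_ac add_ac)
      ultimately show ?thesis using step by linarith
    qed
    note ns = noisy_step_expectation[OF F(1) G(1) G(2) VF Vint V0 VM V0 TM T0 h h1C h2C noise(1) noise(2) eps_mean e_mean var1 var2 K0 c0 le]
    show "integrable M (V (Suc k))" by (rule ns(1))
    show "integrable M (T k)" by (rule ns(2))
    assume g: "g \<in> borel_measurable (F k)" "\<And>\<omega>. 0 \<le> g \<omega>" "\<And>\<omega>. g \<omega> \<le> 1"
    show "(\<integral>\<omega>. g \<omega> * V (Suc k) \<omega> \<partial>M) + (\<integral>\<omega>. g \<omega> * T k \<omega> \<partial>M)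
        \<le> (1 + c k * (1 + K)\<^sup>2) * (\<integral>\<omega>. g \<omega> * V k \<omega> \<partial>M) + c k * (1 + K)\<^sup>2 * (\<integral>\<omega>. g \<omega> \<partial>M)"
      by (rule ns(3)[OF _ _ g])
  qed
  have Vint: "integrable M (V k)" for k
  proof (induction k)
    case 0
    have "V 0 = (\<lambda>_. sq_dist_upto (n + 1) p0 q)"
      unfolding V_def sq_dist_upto_def by (intro ext sum.cong) (auto simp: p_init)
    then show ?case by simp
  qed (rule one_step(1))
  have csum: "summable (\<lambda>k. c k * (1 + K)\<^sup>2)"
    unfolding c_def using sums by (intro summable_mult summable_mult2 summable_add)
  have "AE \<omega> in M. convergent (\<lambda>k. V k \<omega>) \<and> summable (\<lambda>k. T k \<omega>)"
  proof (rule robbins_siegmund[where F = F and a = "\<lambda>k. c k * (1 + K)\<^sup>2" and b = "\<lambda>k. c k * (1 + K)\<^sup>2", OF P F VF Vint V0 one_step(2)[OF Vint] T0 _ csum _ csum])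
    show "0 \<le> c k * (1 + K)\<^sup>2" for k using c0 by simp
    then show "0 \<le> c k * (1 + K)\<^sup>2" for k .
  qed (rule one_step(3)[OF Vint])
  then show ?thesis unfolding V_def T_def .
qed

theorem theorem1:
  fixes M :: "'b measure"
    and A :: "nat \<Rightarrow> 'a::euclidean_space \<Rightarrow> 'a set"
    and B :: "'a \<Rightarrow> 'a"
    and n :: nat and L tau rhobar N1 N2 N3 N4 :: real
    and alpha rho :: "nat \<Rightarrow> real"
    and z :: "nat \<Rightarrow> 'b \<Rightarrow> 'a" and w :: "nat \<Rightarrow> nat \<Rightarrow> 'b \<Rightarrow> 'a"
    and eps e :: "nat \<Rightarrow> 'b \<Rightarrow> 'a"
    and z1 :: 'a and w1 :: "nat \<Rightarrow> 'a"
  assumes P: "prob_space M"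
    and n: "n \<ge> 1"
    and A_mm: "\<And>i. i \<in> {1..n} \<Longrightarrow> maximal_monotone (A i)"
    and B_mono: "monotone_fun B"
    and L_pos: "L > 0"
    and B_lip: "\<And>x y. dist (B x) (B y) \<le> L * dist x y"
    and sol_ex: "\<exists>zs. is_solution A B n zs"
    and tau: "tau > 0"
    and init_sum: "(\<Sum>i=1..n+1. w1 i) = 0"
    and z_init: "\<And>\<omega>. z 1 \<omega> = z1"
    and w_init: "\<And>i \<omega>. i \<in> {1..n+1} \<Longrightarrow> w 1 i \<omega> = w1 i"
    and z_step: "\<And>k \<omega>. k \<ge> 1 \<Longrightarrow> z (Suc k) \<omega> =
        z k \<omega> - alpha k *\<^sub>R (\<Sum>i=1..n+1. sps_y A B n tau (rho k) (z k \<omega>) (\<lambda>i. w k i \<omega>) (eps k \<omega>) (e k \<omega>) i)"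
    and w_step: "\<And>k i \<omega>. k \<ge> 1 \<Longrightarrow> i \<in> {1..n+1} \<Longrightarrow> w (Suc k) i \<omega> =
        w k i \<omega> - alpha k *\<^sub>R (sps_x A B n tau (rho k) (z k \<omega>) (\<lambda>i. w k i \<omega>) (eps k \<omega>) i
          - (1 / real (n + 1)) *\<^sub>R (\<Sum>j=1..n+1. sps_x A B n tau (rho k) (z k \<omega>) (\<lambda>i. w k i \<omega>) (eps k \<omega>) j))"
    and eps_rv: "\<And>k. k \<ge> 1 \<Longrightarrow> eps k \<in> borel_measurable M"
    and e_rv: "\<And>k. k \<ge> 1 \<Longrightarrow> e k \<in> borel_measurable M"
    and eps_int: "\<And>k. k \<ge> 1 \<Longrightarrow> integrable M (eps k)"
    and e_int: "\<And>k. k \<ge> 1 \<Longrightarrow> integrable M (e k)"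
    and eps_mean: "\<And>k b. k \<ge> 1 \<Longrightarrow> b \<in> Basis \<Longrightarrow>
        AE \<omega> in M. real_cond_exp M (sps_filt M n z w k) (\<lambda>\<omega>. inner (eps k \<omega>) b) \<omega> = 0"
    and e_mean: "\<And>k b. k \<ge> 1 \<Longrightarrow> b \<in> Basis \<Longrightarrow>
        AE \<omega> in M. real_cond_exp M (sps_filt M n z w k) (\<lambda>\<omega>. inner (e k \<omega>) b) \<omega> = 0"
    and N_nonneg: "N1 \<ge> 0" "N2 \<ge> 0" "N3 \<ge> 0" "N4 \<ge> 0"
    and eps_var: "\<And>k. k \<ge> 1 \<Longrightarrow>
        AE \<omega> in M. nn_cond_exp M (sps_filt M n z w k) (\<lambda>\<omega>. ennreal ((norm (eps k \<omega>))\<^sup>2)) \<omega>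
          \<le> ennreal (N1 + N2 * (norm (B (z k \<omega>)))\<^sup>2)"
    and e_var: "\<And>k. k \<ge> 1 \<Longrightarrow>
        AE \<omega> in M. nn_cond_exp M (sps_filt_eps M n z w eps k) (\<lambda>\<omega>. ennreal ((norm (e k \<omega>))\<^sup>2)) \<omega>
          \<le> ennreal (N3 + N4 * (norm (B (sps_x A B n tau (rho k) (z k \<omega>) (\<lambda>i. w k i \<omega>) (eps k \<omega>) (n + 1))))\<^sup>2)"
    and alpha_pos: "\<And>k. k \<ge> 1 \<Longrightarrow> alpha k > 0"
    and rho_pos: "\<And>k. k \<ge> 1 \<Longrightarrow> rho k > 0"
    and sum_ar: "\<not> summable (\<lambda>k. alpha (Suc k) * rho (Suc k))"
    and sum_a2: "summable (\<lambda>k. (alpha (Suc k))\<^sup>2)"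
    and sum_ar2: "summable (\<lambda>k. alpha (Suc k) * (rho (Suc k))\<^sup>2)"
    and rho_bound: "\<And>k. k \<ge> 1 \<Longrightarrow> rho k \<le> rhobar"
    and rhobar_L: "rhobar < 1 / L"
  shows "AE \<omega> in M. \<exists>zs. (\<lambda>k. z k \<omega>) \<longlonglongrightarrow> zs \<and> is_solution A B n zs"
proof -
  interpret prob_space M by fact
  interpret S: sps A B n L tau
    using A_mm B_mono L_pos B_lip tau by unfold_locales
  \<comment> \<open>Time is shifted by one: the algorithm starts at 1, the abstract sequences at 0,
    so \<open>p k\<close> is the state with index \<open>Suc k\<close>.\<close>
  define p where "p k \<omega> i = (if i = 0 then z (Suc k) \<omega> else w (Suc k) i \<omega>)" for k \<omega> i
  define al where "al k = alpha (Suc k)" for k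
  define rh where "rh k = rho (Suc k)" for k
  define ep where "ep k = eps (Suc k)" for k
  define er where "er k = e (Suc k)" for k
  define F where "F k = sps_filt M n z w (Suc k)" for k
  define G where "G k = sps_filt_eps M n z w eps (Suc k)" for k
  have X: "sps_x A B n tau r (z (Suc k) \<omega>) (\<lambda>i. w (Suc k) i \<omega>) v i = S.X r (p k \<omega>) v i" if "i \<ge> 1" for r k \<omega> v i
    using that by (auto simp: sps_x_def p_def)
  have Y: "sps_y A B n tau r (z (Suc k) \<omega>) (\<lambda>i. w (Suc k) i \<omega>) v v' i = S.Y r (p k \<omega>) v v' i" if "i \<ge> 1" for r k \<omega> v v' i
    using that by (auto simp: sps_y_def X) (auto simp: p_def)
  have p0: "p (Suc k) \<omega> 0 = p k \<omega> 0 - al k *\<^sub>R (\<Sum>i=1..n+1. S.Y (rh k) (p k \<omega>) (ep k \<omega>) (er k \<omega>) i)" for k \<omega>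
  proof -
    have "(\<Sum>i=1..n+1. sps_y A B n tau (rho (Suc k)) (z (Suc k) \<omega>) (\<lambda>i. w (Suc k) i \<omega>) (eps (Suc k) \<omega>) (e (Suc k) \<omega>) i)
        = (\<Sum>i=1..n+1. S.Y (rh k) (p k \<omega>) (ep k \<omega>) (er k \<omega>) i)"
      unfolding rh_def ep_def er_def by (intro sum.cong refl Y) auto
    then show ?thesis using z_step[of "Suc k" \<omega>] unfolding p_def al_def by simp
  qed
  have pi: "p (Suc k) \<omega> i = p k \<omega> i - al k *\<^sub>R (S.X (rh k) (p k \<omega>) (ep k \<omega>) i
      - (1 / real (n + 1)) *\<^sub>R (\<Sum>j=1..n+1. S.X (rh k) (p k \<omega>) (ep k \<omega>) j))" if i: "i \<in> {1..n+1}" for k \<omega> i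
  proof -
    have i1: "i \<ge> 1" using i by simp
    have "(\<Sum>j=1..n+1. sps_x A B n tau (rho (Suc k)) (z (Suc k) \<omega>) (\<lambda>i. w (Suc k) i \<omega>) (eps (Suc k) \<omega>) j)
        = (\<Sum>j=1..n+1. S.X (rh k) (p k \<omega>) (ep k \<omega>) j)"
      unfolding rh_def ep_def by (intro sum.cong refl X) auto
    then show ?thesis
      using w_step[of "Suc k" i \<omega>] i i1 X[OF i1, of "rho (Suc k)" k \<omega> "eps (Suc k) \<omega>"]
      unfolding rh_def ep_def al_def by (simp add: p_def)
  qed
  have p_init: "p 0 \<omega> i = (if i = 0 then z1 else w1 i)" if "i \<le> n + 1" for i \<omega>
    using that z_init w_init[of i] by (auto simp: p_def)
  \<comment> \<open>The deviations of the \<open>x_i\<close> from their mean sum to zero, so the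
    step preserves the zero sum of the dual components.\<close>
  have p_sum: "(\<Sum>i=1..n+1. p k \<omega> i) = 0" for k \<omega>
  proof (induction k)
    case 0
    have "(\<Sum>i=1..n+1. p 0 \<omega> i) = (\<Sum>i=1..n+1. w1 i)" by (intro sum.cong) (auto simp: p_init)
    then show ?case using init_sum by simp
  next
    case (Suc k)
    let ?x = "S.X (rh k) (p k \<omega>) (ep k \<omega>)"
    have "(\<Sum>i=1..n+1. p (Suc k) \<omega> i) = (\<Sum>i=1..n+1. p k \<omega> i - al k *\<^sub>R (?x i - (1 / real (n + 1)) *\<^sub>R (\<Sum>j=1..n+1. ?x j)))"
      by (intro sum.cong refl pi)
    also have "\<dots> = (\<Sum>i=1..n+1. p k \<omega> i) - al k *\<^sub>R ((\<Sum>i=1..n+1. ?x i)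
        - (1 / real (n + 1)) *\<^sub>R real (card {1..n+1}) *\<^sub>R (\<Sum>j=1..n+1. ?x j))"
      by (simp only: sum_subtractf scaleR_sum_right[symmetric] sum_constant_scaleR)
    also have "\<dots> = 0" using Suc by simp
    finally show ?case .
  qed
  have noise: "ep k \<in> borel_measurable M" "er k \<in> borel_measurable M" for k
    using eps_rv[of "Suc k"] e_rv[of "Suc k"] by (auto simp: ep_def er_def)
  \<comment> \<open>That the generated sigma-algebras are subalgebras of \<open>M\<close> rests on
    the iterates being random variables; this follows along the recursion from continuity of the
    resolvents and of \<open>B\<close>.\<close>
  have pM: "(\<lambda>\<omega>. p k \<omega> i) \<in> borel_measurable M" if "i \<le> n + 1" for k i
    using that
  proof (induction k arbitrary: i)
    case 0
    then show ?case by (simp add: p_init cong: measurable_cong)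
  next
    case (Suc k)
    note IH = Suc.IH
    have xM: "(\<lambda>\<omega>. S.X (rh k) (p k \<omega>) (ep k \<omega>) j) \<in> borel_measurable M" if j: "j \<in> {1..n+1}" for j
    proof (cases "j = n + 1")
      case True
      have "(\<lambda>\<omega>. B (p k \<omega> 0)) \<in> borel_measurable M"
        using IH[of 0] by (intro measurable_compose[OF _ borel_measurable_continuous_onI[OF S.continuous_B]]) auto
      then show ?thesis using True IH[of 0] IH[of "n + 1"] noise[of k] by (simp add: sps_x_def)
    next
      case False
      then have j': "j \<in> {1..n}" using j by auto
      have "(\<lambda>\<omega>. resolvent tau (A j) (p k \<omega> 0 + tau *\<^sub>R p k \<omega> j)) \<in> borel_measurable M"
        using IH[of 0] IH[of j] j
        by (intro measurable_compose[OF _ borel_measurable_continuous_onI[OF continuous_resolvent[OF A_mm[OF j'] tau]]]) auto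
      then show ?thesis using j' by (simp add: sps_x_def)
    qed
    have yM: "(\<lambda>\<omega>. S.Y (rh k) (p k \<omega>) (ep k \<omega>) (er k \<omega>) j) \<in> borel_measurable M" if j: "j \<in> {1..n+1}" for j
    proof (cases "j = n + 1")
      case True
      have "(\<lambda>\<omega>. B (S.X (rh k) (p k \<omega>) (ep k \<omega>) (n + 1))) \<in> borel_measurable M"
        using xM[of "n + 1"] by (intro measurable_compose[OF _ borel_measurable_continuous_onI[OF S.continuous_B]]) auto
      then show ?thesis using True noise[of k] by (simp add: sps_y_def)
    next
      case False
      then show ?thesis using j IH[of 0] IH[of j] xM[OF j] by (simp add: sps_y_def)
    qed
    show ?case
    proof (cases "i = 0")
      case True
      show ?thesis unfolding True p0
        by (intro borel_measurable_diff borel_measurable_scaleR borel_measurable_sum yM IH borel_measurable_const) auto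
    next
      case False
      then have i: "i \<in> {1..n+1}" using Suc.prems by auto
      show ?thesis unfolding pi[OF i]
        by (intro borel_measurable_diff borel_measurable_scaleR borel_measurable_sum xM IH borel_measurable_const)
          (use i in auto)
    qed
  qed
  have zM: "z j \<in> borel_measurable M" if "1 \<le> j" for j
    using that pM[of 0 "j - 1"] by (simp add: p_def)
  have wM: "w j i \<in> borel_measurable M" if "1 \<le> j" "1 \<le> i" "i \<le> n + 1" for j i
    using that pM[of i "j - 1"] by (simp add: p_def)
  have F: "subalgebra M (F k)" for k
    unfolding F_def sps_filt_def by (rule subalgebra_gen_sigma) (use zM wM in auto)
  have FS: "subalgebra (F (Suc k)) (F k)" for k
    unfolding F_def sps_filt_def by (rule subalgebra_gen_sigma_mono) fastforce
  have G: "subalgebra M (G k)" for k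
    unfolding G_def sps_filt_eps_def by (rule subalgebra_gen_sigma) (use zM wM eps_rv in auto)
  have GF: "subalgebra (G k) (F k)" for k
    unfolding F_def G_def sps_filt_def sps_filt_eps_def by (rule subalgebra_gen_sigma_mono) auto
  have pF: "(\<lambda>\<omega>. p k \<omega> i) \<in> borel_measurable (F k)" if "i \<le> n + 1" for k i
    unfolding F_def sps_filt_def
  proof (rule measurable_gen_sigma, cases "i = 0")
    case True
    then have "(\<lambda>\<omega>. p k \<omega> i) = z (Suc k)" by (simp add: p_def)
    then show "(\<lambda>\<omega>. p k \<omega> i) \<in> {z j |j. 1 \<le> j \<and> j \<le> Suc k} \<union> {w j i |j i. 1 \<le> j \<and> j \<le> Suc k \<and> 1 \<le> i \<and> i \<le> n + 1}"
      by auto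
  next
    case False
    then have "(\<lambda>\<omega>. p k \<omega> i) = w (Suc k) i" "1 \<le> i" by (auto simp: p_def)
    then show "(\<lambda>\<omega>. p k \<omega> i) \<in> {z j |j. 1 \<le> j \<and> j \<le> Suc k} \<union> {w j i |j i. 1 \<le> j \<and> j \<le> Suc k \<and> 1 \<le> i \<and> i \<le> n + 1}"
      using that by (intro UnI2 CollectI exI[of _ "Suc k"] exI[of _ i]) auto
  qed
  have Lr: "L * rhobar < 1" using rhobar_L L_pos by (simp add: field_simps)
  define \<delta> where "\<delta> = 1 - L * rhobar"
  have \<delta>: "\<delta> > 0" using Lr by (simp add: \<delta>_def)
  have al: "al k > 0" and rh: "rh k > 0" "rh k \<le> rhobar" for k
    using alpha_pos[of "Suc k"] rho_pos[of "Suc k"] rho_bound[of "Suc k"] by (auto simp: al_def rh_def)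
  have e_var': "AE \<omega> in M. nn_cond_exp M (G k) (\<lambda>\<omega>. ennreal ((norm (er k \<omega>))\<^sup>2)) \<omega>
          \<le> ennreal (N3 + N4 * (norm (B (S.X (rh k) (p k \<omega>) (ep k \<omega>) (n + 1))))\<^sup>2)" for k
    using e_var[of "Suc k"] X[of "n + 1" "rho (Suc k)" k] unfolding G_def er_def rh_def ep_def by simp
  have fejer: "AE \<omega> in M. convergent (\<lambda>k. sq_dist_upto (n + 1) (p k \<omega>) q) \<and>
    summable (\<lambda>k. 2 * al k * (S.resolvent_residual (p k \<omega>) / tau
      + rh k * (1 - L * rhobar) * (norm (S.forward_residual (p k \<omega>)))\<^sup>2))" if q: "S.extended_solution q" for q
  proof (rule S.AE_quasi_fejer[where F = F and G = G and eps = ep and e = er and alpha = al and rho = rh,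
        OF P F FS G GF pF noise p_init p_sum p0 pi _ _ N_nonneg _ e_var' al rh Lr _ _ q])
    show "AE \<omega> in M. real_cond_exp M (F k) (\<lambda>\<omega>. inner (ep k \<omega>) b) \<omega> = 0" if "b \<in> Basis" for k b
      using eps_mean[of "Suc k" b] that by (simp add: F_def ep_def)
    show "AE \<omega> in M. real_cond_exp M (F k) (\<lambda>\<omega>. inner (er k \<omega>) b) \<omega> = 0" if "b \<in> Basis" for k b
      using e_mean[of "Suc k" b] that by (simp add: F_def er_def)
    show "AE \<omega> in M. nn_cond_exp M (F k) (\<lambda>\<omega>. ennreal ((norm (ep k \<omega>))\<^sup>2)) \<omega>
          \<le> ennreal (N1 + N2 * (norm (B (p k \<omega> 0)))\<^sup>2)" for k
      using eps_var[of "Suc k"] by (simp add: F_def ep_def p_def)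
    show "summable (\<lambda>k. (al k)\<^sup>2)" "summable (\<lambda>k. al k * (rh k)\<^sup>2)"
      using sum_a2 sum_ar2 by (simp_all add: al_def rh_def)
  qed
  obtain T where T: "countable T" "T \<subseteq> Collect S.extended_solution"
    and Tdense: "\<And>q r. S.extended_solution q \<Longrightarrow> r > 0 \<Longrightarrow> \<exists>t\<in>T. sqrt (sq_dist_upto (n + 1) t q) < r"
    using sq_dist_upto_separable[of "Collect S.extended_solution" "n + 1"] by auto
  obtain q0 where q0: "S.extended_solution q0" using sol_ex S.is_solution_iff_extended by blast
  obtain t0 where t0: "t0 \<in> T" using Tdense[OF q0, of 1] by auto
  \<comment> \<open>Intersection of countably many almost sure events. The residual series is the
    same for every \<open>t\<close> and is later read off at the single point
    \<open>t0\<close>.\<close>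
  have "AE \<omega> in M. \<forall>t\<in>T. convergent (\<lambda>k. sq_dist_upto (n + 1) (p k \<omega>) t) \<and>
    summable (\<lambda>k. 2 * al k * (S.resolvent_residual (p k \<omega>) / tau
      + rh k * (1 - L * rhobar) * (norm (S.forward_residual (p k \<omega>)))\<^sup>2))"
    using fejer T by (subst AE_ball_countable) auto
  then show ?thesis
  proof eventually_elim
    case (elim \<omega>)
    let ?R = "\<lambda>k. S.resolvent_residual (p k \<omega>)" and ?U = "\<lambda>k. (norm (S.forward_residual (p k \<omega>)))\<^sup>2"
    \<comment> \<open>\<open>D\<close> serves both weights: \<open>tau * rhobar / 2\<close> lifts
      \<open>2 * R / tau\<close> to \<open>rhobar * R\<close>, which dominates
      \<open>rh k * R\<close>; \<open>1 / (2 * \<delta>)\<close> removes \<open>2 * \<delta>\<close>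
      from the forward term; the remaining cross products are nonnegative.\<close>
    define D where "D = tau * rhobar / 2 + 1 / (2 * \<delta>)"
    have rb: "rhobar > 0" using rh[of 0] by linarith
    have "\<exists>zs. (\<lambda>k. p k \<omega> 0) \<longlonglongrightarrow> zs \<and> is_solution A B n zs"
    proof (rule S.path_converges[where T = T and a = "\<lambda>k. al k * rh k", OF _ T(2) Tdense _ p_sum])
      show "summable (\<lambda>k. al k * rh k * (?R k + ?U k))"
      proof (rule summable_comparison_test')
        show "summable (\<lambda>k. D * (2 * al k * (?R k / tau + rh k * (1 - L * rhobar) * ?U k)))"
          using elim t0 by (intro summable_mult) blast
        fix k :: nat assume "k \<ge> 0"
        have R0: "0 \<le> ?R k" by (simp add: S.resolvent_residual_def sum_nonneg)
        have "rh k * ?R k \<le> rhobar * ?R k" using rh R0 by (intro mult_right_mono) auto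
        moreover have "D * (2 * (?R k / tau + rh k * \<delta> * ?U k))
            = rhobar * ?R k + rh k * ?U k + (tau * rhobar * rh k * \<delta> * ?U k + ?R k / (tau * \<delta>))"
          using tau \<delta> by (simp add: D_def field_simps)
        moreover have "0 \<le> tau * rhobar * rh k * \<delta> * ?U k + ?R k / (tau * \<delta>)"
          using tau \<delta> rb rh[of k] R0 by (intro add_nonneg_nonneg mult_nonneg_nonneg divide_nonneg_pos) auto
        ultimately have "rh k * (?R k + ?U k) \<le> D * (2 * (?R k / tau + rh k * \<delta> * ?U k))"
          by (simp add: distrib_left)
        then have "al k * (rh k * (?R k + ?U k)) \<le> al k * (D * (2 * (?R k / tau + rh k * \<delta> * ?U k)))"
          using al[of k] by (intro mult_left_mono) auto
        moreover have "0 \<le> al k * rh k * (?R k + ?U k)" using al[of k] rh[of k] R0 by simp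
        ultimately show "norm (al k * rh k * (?R k + ?U k)) \<le> D * (2 * al k * (?R k / tau + rh k * (1 - L * rhobar) * ?U k))"
          unfolding \<delta>_def by (simp only: real_norm_def abs_of_nonneg) (simp only: mult_ac)
      qed
      show "\<not> summable (\<lambda>k. al k * rh k)" using sum_ar by (simp add: al_def rh_def)
      show "0 \<le> al k * rh k" for k using al[of k] rh[of k] by simp
    qed (use q0 elim in auto)
    then show ?case
      by (simp add: p_def filterlim_sequentially_Suc[of "\<lambda>k. z k \<omega>"])
  qed
qed

end
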